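(* Let $C\subset\mathbb{R}^m$ be an open convex cone such that its closure $\mathrm{cl}(C)$ contains no lines. Let $\mathcal{T}$ be a locally finite tessellation of $C$ such that each $\sigma\in\mathcal{T}$ is a top-dimensional polyhedral cone contained in $\mathrm{cl}(C)$ and every codimension-$1$ face is shared by exactly two tiles. Let a group $\Gamma$ act linearly on $\mathbb{R}^m$, preserving orientation and the tessellation $\mathcal{T}$, with $\mathcal{T}/\Gamma$ finite, and assume that for every $\sigma\in\mathcal{T}$ the stabilizer $\Gamma_\sigma=\{\gamma\in\Gamma:\gamma\cdot\sigma=\sigma\}$ is finite. Let $\Sigma^{\mathcal{T}}_m$ and $\Sigma^{\mathcal{T}}_{m-1}$ be sets of $\Gamma$-representatives of, respectively, codimension-$0$ and codimension-$1$ faces whose stabilizers do not reverse their orientation. Let $\mathcal{S}\subset\Sigma^{\mathcal{T}}_m$ and let $\lambda_\sigma\in\mathbb{Q}$ for $\sigma\in\mathcal{S}$. Then $$\sum_{\sigma\in\mathcal{S}}\lambda_\sigma\Bigl(\sum_{\tau\in\Sigma^{\mathcal{T}}_{m-1}}[\sigma:\tau]\,\tau\Bigr)=0$$ if and only if $\mathcal{S}=\Sigma^{\mathcal{T}}_m$ and $\lambda_\sigma=\frac{\lambda}{|\Gamma_\sigma|}$ for every $\sigma\in\mathcal{S}$, for some $\lambda\in\mathbb{Q}$.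
   Context: A tessellation of $C$ is a family of cones (tiles) with pairwise disjoint interiors covering $C$. Codimension-$0$ faces are the tiles themselves; codimension-$1$ faces are the codimension-$1$ faces of tiles. For a face $\sigma$ let $\mathbb{R}(\sigma)$ denote its real linear span, and for a tile $\sigma$ let $\mathcal{F}^1(\sigma)$ be the set of its codimension-$1$ faces. The stabilizer of a face reverses its orientation if some element of it acts on $\mathbb{R}(\sigma)$ with negative determinant. The displayed sum is taken in the $\mathbb{Q}$-vector space with basis $\Sigma^{\mathcal{T}}_{m-1}$. Orientations and signs: every tile $\sigma$ has $\mathbb{R}(\sigma)=\mathbb{R}^m$ with the standard orientation; orientations of the spans $\mathbb{R}(\tau)$ of codimension-$1$ faces are fixed. For a tile $\sigma$ and $\tau'\in\mathcal{F}^1(\sigma)$, let $\mathcal{B}'$ be a positively oriented basis of $\mathbb{R}(\tau')$ and $v$ a generator of an extreme ray of $\sigma$ not contained in $\tau'$; $\varepsilon(\sigma,\tau')=1$ if $(\mathcal{B}',v)$ is a positively oriented basis of $\mathbb{R}^m$ and $-1$ otherwise (independent of $v$). For $\tau\in\Sigma^{\mathcal{T}}_{m-1}$ and $\tau'=\gamma\cdot\tau$ with $\gamma\in\Gamma$, $\eta(\tau,\tau')=1$ if $\gamma$ sends a positively oriented basis of $\mathbb{R}(\tau)$ to a positively oriented basis of $\mathbb{R}(\tau')$, and $-1$ otherwise. Finally $$[\sigma:\tau]=\sum_{\tau'\in\mathrm{Orb}_\sigma(\tau)}\eta(\tau,\tau')\,\varepsilon(\sigma,\tau'),\qquad \mathrm{Orb}_\sigma(\tau)=\{\tau'\in\mathcal{F}^1(\sigma):\exists\gamma\in\Gamma,\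 \tau'=\gamma\cdot\tau\}.$$
   Formalization: It is assumed that λ_σ ≠ 0 for at least one σ in S, since with all λ_σ = 0 (for instance S empty) the sum vanishes although S need not equal Σ_m; the degenerate case m = 0 is not covered. *)

theory Defs
  imports
    "HOL-Analysis.Analysis"
    "HOL-Algebra.Group_Action"
    "HOL-Library.Poly_Mapping"
    "Jordan_Normal_Form.Determinant"
begin

text \<open>
  The notation \<open>real ^ 'n\<close> adds the sort \<open>finite\<close> to every occurrence of \<open>'n\<close>; the synonym does not.
  The index type carries a linear order because the standard orientation depends on the order of
  the standard basis.
\<close>

type_synonym 'n rvec = "(real, 'n) Finite_Cartesian_Product.vec"

text \<open>
  The library predicate \<^const>\<open>cone\<close> demands closure under multiplication by 0, which no proper
  open cone satisfies, so open cones only require positive factors.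
\<close>

definition open_convex_cone :: "'a::real_normed_vector set \<Rightarrow> bool" where
  "open_convex_cone C \<longleftrightarrow> open C \<and> convex C \<and> (\<forall>x\<in>C. \<forall>c>0. c *\<^sub>R x \<in> C)"

definition contains_no_lines :: "'a::euclidean_space set \<Rightarrow> bool" where
  "contains_no_lines A \<longleftrightarrow> (\<nexists>L. affine L \<and> aff_dim L = 1 \<and> L \<subseteq> A)"

definition polyhedral_cone :: "'a::euclidean_space set \<Rightarrow> bool" where
  "polyhedral_cone \<sigma> \<longleftrightarrow> polyhedron \<sigma> \<and> cone \<sigma> \<and> \<sigma> \<noteq> {}"

definition tessellation :: "'a::real_normed_vector set \<Rightarrow> 'a set set \<Rightarrow> bool" where
  "tessellation C T \<longleftrightarrow>
     (\<forall>\<sigma>\<in>T. cone \<sigma>) \<and> pairwise (\<lambda>\<sigma> \<sigma>'. interior \<sigma> \<inter> interior \<sigma>' = {}) T \<and> C \<subseteq> \<Union>T"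

text \<open>
  Local finiteness is required at the points of \<open>C\<close> only; tiles may accumulate at the boundary.
\<close>

definition locally_finite_on :: "'a::topological_space set \<Rightarrow> 'a set set \<Rightarrow> bool" where
  "locally_finite_on C T \<longleftrightarrow>
     (\<forall>x\<in>C. \<exists>U. open U \<and> x \<in> U \<and> finite {\<sigma> \<in> T. \<sigma> \<inter> U \<noteq> {}})"

definition facets :: "'a::euclidean_space set \<Rightarrow> 'a set set" where
  "facets \<sigma> = {\<tau>. \<tau> facet_of \<sigma>}"

definition codim1_faces :: "'a::euclidean_space set set \<Rightarrow> 'a set set" where
  "codim1_faces T = (\<Union>\<sigma>\<in>T. facets \<sigma>)"

text \<open>
  Ordered bases are lists. The matrix in \<open>coord_det bs cs\<close> has as its \<open>j\<close>-th column the coordinates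
  of \<open>cs ! j\<close> in the ordered basis \<open>bs\<close>. An orientation is an equivalence class of ordered bases
  under change of basis with positive determinant; its members are the positively oriented bases.
\<close>

definition ordered_basis :: "'a::real_vector set \<Rightarrow> 'a list \<Rightarrow> bool" where
  "ordered_basis V bs \<longleftrightarrow> distinct bs \<and> independent (set bs) \<and> span (set bs) = V"

definition coord_det :: "'a::real_vector list \<Rightarrow> 'a list \<Rightarrow> real" where
  "coord_det bs cs =
     Determinant.det (Matrix.mat (length bs) (length bs)
       (\<lambda>(i, j). representation (set bs) (cs ! j) (bs ! i)))"

definition orientation_class :: "'a::real_vector set \<Rightarrow> 'a list \<Rightarrow> 'a list set" where
  "orientation_class V bs = {cs. ordered_basis V cs \<and> coord_det bs cs > 0}"

definition orientations :: "'a::real_vector set \<Rightarrow> 'a list set set" where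
  "orientations V = {orientation_class V bs |bs. ordered_basis V bs}"

definition standard_orientation :: "'n::{finite,linorder} rvec list set" where
  "standard_orientation =
     orientation_class UNIV (map (\<lambda>i. axis i 1) (sorted_list_of_set (UNIV :: 'n set)))"

text \<open>Only meaningful for a linear \<open>f\<close> mapping the finite-dimensional subspace \<open>V\<close> to itself.\<close>

definition det_on :: "'a::real_vector set \<Rightarrow> ('a \<Rightarrow> 'a) \<Rightarrow> real" where
  "det_on V f = (let bs = (SOME bs. ordered_basis V bs) in coord_det bs (map f bs))"

definition act_on_sets :: "('g \<Rightarrow> 'a \<Rightarrow> 'a) \<Rightarrow> 'g \<Rightarrow> 'a set \<Rightarrow> 'a set" where
  "act_on_sets \<phi> g \<sigma> = \<phi> g ` \<sigma>"

definition stabilizer_reverses ::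
    "('g, 'k) monoid_scheme \<Rightarrow> ('g \<Rightarrow> 'a \<Rightarrow> 'a) \<Rightarrow> 'a::real_vector set \<Rightarrow> bool" where
  "stabilizer_reverses G \<phi> \<sigma> \<longleftrightarrow>
     (\<exists>g \<in> stabilizer G (act_on_sets \<phi>) \<sigma>. det_on (span \<sigma>) (\<phi> g) < 0)"

definition representatives ::
    "('g, 'k) monoid_scheme \<Rightarrow> ('g \<Rightarrow> 'a \<Rightarrow> 'a) \<Rightarrow> 'a set set \<Rightarrow> 'a set set \<Rightarrow> bool" where
  "representatives G \<phi> F R \<longleftrightarrow> R \<subseteq> F \<and> (\<forall>\<sigma>\<in>F. \<exists>!\<rho>. \<rho> \<in> R \<and> \<rho> \<in> orbit G (act_on_sets \<phi>) \<sigma>)"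

definition extreme_ray_generator :: "'a::real_vector set \<Rightarrow> 'a \<Rightarrow> bool" where
  "extreme_ray_generator \<sigma> v \<longleftrightarrow> v \<noteq> 0 \<and> {c *\<^sub>R v |c. c \<ge> 0} face_of \<sigma>"

text \<open>
  In the rest of the theory \<open>ori \<tau>\<close> is the orientation chosen for \<open>span \<tau>\<close>. The signs do not depend
  on the choices of basis, of \<open>v\<close> and, if the stabilizer of \<open>\<tau>\<close> does not reverse the orientation,
  of \<open>g\<close>; these choices are therefore quantified existentially.
\<close>

definition eps_sign ::
    "('n rvec set \<Rightarrow> 'n rvec list set) \<Rightarrow> 'n::{finite,linorder} rvec set \<Rightarrow>
      'n rvec set \<Rightarrow> int" where
  "eps_sign ori \<sigma> \<tau>' =
     (if \<exists>bs v. bs \<in> ori \<tau>' \<and> extreme_ray_generator \<sigma> v \<and> \<not> {c *\<^sub>R v |c. c \<ge> 0} \<subseteq> \<tau>' \<and>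
           bs @ [v] \<in> standard_orientation
      then 1 else - 1)"

definition eta_sign ::
    "('g, 'k) monoid_scheme \<Rightarrow> ('g \<Rightarrow> 'a \<Rightarrow> 'a) \<Rightarrow> ('a set \<Rightarrow> 'a list set) \<Rightarrow> 'a set \<Rightarrow> 'a set \<Rightarrow> int"
    where
  "eta_sign G \<phi> ori \<tau> \<tau>' =
     (if \<exists>g \<in> carrier G. \<tau>' = act_on_sets \<phi> g \<tau> \<and> (\<exists>bs \<in> ori \<tau>. map (\<phi> g) bs \<in> ori \<tau>')
      then 1 else - 1)"

definition orb_in ::
    "('g, 'k) monoid_scheme \<Rightarrow> ('g \<Rightarrow> 'a \<Rightarrow> 'a) \<Rightarrow> 'a::euclidean_space set \<Rightarrow> 'a set \<Rightarrow> 'a set set"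
    where
  "orb_in G \<phi> \<sigma> \<tau> = {\<tau>' \<in> facets \<sigma>. \<exists>g \<in> carrier G. \<tau>' = act_on_sets \<phi> g \<tau>}"

definition incidence ::
    "('g, 'k) monoid_scheme \<Rightarrow> ('g \<Rightarrow> 'n rvec \<Rightarrow> 'n rvec) \<Rightarrow>
      ('n rvec set \<Rightarrow> 'n rvec list set) \<Rightarrow> 'n::{finite,linorder} rvec set \<Rightarrow>
      'n rvec set \<Rightarrow> int" where
  "incidence G \<phi> ori \<sigma> \<tau> = (\<Sum>\<tau>' \<in> orb_in G \<phi> \<sigma> \<tau>. eta_sign G \<phi> ori \<tau> \<tau>' * eps_sign ori \<sigma> \<tau>')"

text \<open>
  Finitely supported functions \<open>'b \<Rightarrow>\<^sub>0 rat\<close> are the rational vector space with basis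
  \<open>Poly_Mapping.single b 1\<close>; \<open>Poly_Mapping\<close> has no scalar multiplication by itself.
\<close>

definition scale_rat :: "rat \<Rightarrow> ('b \<Rightarrow>\<^sub>0 rat) \<Rightarrow> ('b \<Rightarrow>\<^sub>0 rat)" where
  "scale_rat q x = Poly_Mapping.map ((*) q) x"

end

theory Submission
  imports Defs
begin

text \<open>
  Extend the coefficients to all tiles by \<open>\<mu>(\<rho>) = \<lambda>\<^sub>\<sigma> |\<Gamma>\<^sub>\<sigma>|\<close> if \<open>\<rho>\<close> lies in the orbit of some
  \<open>\<sigma> \<in> S\<close>, and \<open>\<mu>(\<rho>) = 0\<close> otherwise; this is \<open>spread\<close> below. The theorem says that the boundary of the
  chain vanishes iff \<open>\<mu>\<close> is constant on the tessellation. A constant \<open>\<mu>\<close> is nonzero because some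
  \<open>\<lambda>\<^sub>\<sigma>\<close> is, so no orbit of tiles is missing from \<open>S\<close>, and \<open>\<lambda>\<^sub>\<sigma> = \<mu> / |\<Gamma>\<^sub>\<sigma>|\<close>.

  Fix a representative \<open>\<tau>\<close> of the facets, and count the \<open>\<gamma>\<close> for which \<open>\<gamma>\<tau>\<close> is a facet of \<open>\<sigma>\<close> in two
  ways: by the facet \<open>\<gamma>\<tau>\<close> (each occurs \<open>|\<Gamma>\<^sub>\<tau>|\<close> times), and by the tile \<open>\<gamma>\<inverse>\<sigma>\<close>, which has \<open>\<tau>\<close> as
  a facet (each occurs \<open>|\<Gamma>\<^sub>\<sigma>|\<close> times). The signs agree because \<open>\<Gamma>\<close> preserves the orientation of
  the ambient space (\<open>eta_eps_equivariant\<close>), so \<open>|\<Gamma>\<^sub>\<tau>|\<close> times the coefficient of \<open>\<tau>\<close> is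
  \<open>\<Sum>\<^sub>\<rho> \<epsilon>(\<rho>, \<tau>) \<mu>(\<rho>)\<close> over the tiles \<open>\<rho>\<close> with facet \<open>\<tau>\<close> (\<open>coefficient_eq\<close>). There are two of them,
  they lie on opposite sides of \<open>\<tau>\<close> and so have opposite signs, and the coefficient vanishes iff
  \<open>\<mu>\<close> takes the same value on both (\<open>coefficient_zero_iff\<close>). If the stabilizer of a facet reverses its
  orientation, then an element that does so preserves the orientation of the ambient space, hence
  swaps the two tiles, and \<open>\<mu>\<close> agrees on them by invariance (\<open>spread_equal_if_reversed\<close>).

  It remains to pass from adjacent tiles to all tiles (\<open>constant_if_adjacent_equal\<close>). Join interior points
  of two tiles by a segment that misses all faces of codimension 2, which a generic endpoint
  achieves. If \<open>\<mu>\<close> took two values, the segment would, being connected, contain a point at which tiles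
  of different value meet; but near a point in the relative interior of a facet there are only the
  two tiles that share this facet.
\<close>

no_notation Matrix.scalar_prod (infix \<open>\<bullet>\<close> 70)

section \<open>Change-of-basis determinants\<close>

lemma ordered_basis_length:
  fixes V :: "'a::euclidean_space set"
  assumes "ordered_basis V bs"
  shows "length bs = dim V"
proof -
  have "dim V = card (set bs)"
    using assms unfolding ordered_basis_def
    by (metis dim_eq_card dim_span)
  with assms show ?thesis by (simp add: ordered_basis_def distinct_card)
qed

lemma ordered_basis_expansion:
  assumes bs: "ordered_basis V bs" and x: "x \<in> V"
  shows "x = (\<Sum>k<length bs. representation (set bs) x (bs ! k) *\<^sub>R bs ! k)"
proof -
  have "bij_betw (nth bs) {..<length bs} (set bs)"
    using bs by (auto simp: ordered_basis_def intro: bij_betw_nth)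
  then have "(\<Sum>k<length bs. representation (set bs) x (bs ! k) *\<^sub>R bs ! k)
      = (\<Sum>b\<in>set bs. representation (set bs) x b *\<^sub>R b)"
    by (rule sum.reindex_bij_betw)
  also have "\<dots> = x"
    using bs x by (intro real_vector.sum_representation_eq) (auto simp: ordered_basis_def)
  finally show ?thesis ..
qed

text \<open>
  The coordinate matrix of \<open>cs\<close> in \<open>as\<close> is the product of two coordinate matrices. Dependent lists \<open>cs\<close> are
  included so that the determinant of \<open>(cs, w)\<close> can be followed while \<open>w\<close> crosses a hyperplane.
\<close>

lemma coord_det_mult:
  fixes V :: "'a::euclidean_space set"
  assumes as: "ordered_basis V as" and bs: "ordered_basis V bs"
    and cs: "length cs = length bs" "set cs \<subseteq> V"
  shows "coord_det as cs = coord_det as bs * coord_det bs cs"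
proof -
  define n where "n = length bs"
  have la: "length as = n" using ordered_basis_length[OF as] ordered_basis_length[OF bs] n_def by simp
  define A where "A = Matrix.mat n n (\<lambda>(i, j). representation (set as) (bs ! j) (as ! i))"
  define B where "B = Matrix.mat n n (\<lambda>(i, j). representation (set bs) (cs ! j) (bs ! i))"
  have ind: "independent (set as)" and V: "V = span (set as)"
    using as by (auto simp: ordered_basis_def)
  have bV: "bs ! k \<in> span (set as)" if "k < n" for k
    using bs that V unfolding ordered_basis_def n_def
    by (metis nth_mem span_base)
  have "representation (set as) (cs ! j) (as ! i) =
      (\<Sum>k<n. representation (set bs) (cs ! j) (bs ! k) * representation (set as) (bs ! k) (as ! i))"
    if "j < n" for i j
  proof -
    have "cs ! j \<in> V" using cs that n_def by auto
    then have e: "cs ! j = (\<Sum>k<n. representation (set bs) (cs ! j) (bs ! k) *\<^sub>R bs ! k)"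
      using ordered_basis_expansion[OF bs] n_def by blast
    have "representation (set as) (cs ! j) =
        representation (set as) (\<Sum>k<n. representation (set bs) (cs ! j) (bs ! k) *\<^sub>R bs ! k)"
      using e by simp
    also have "\<dots> = (\<lambda>b. \<Sum>k<n. representation (set as)
        (representation (set bs) (cs ! j) (bs ! k) *\<^sub>R bs ! k) b)"
      using bV by (intro real_vector.representation_sum[OF ind] real_vector.span_scale) simp
    finally show ?thesis
      using bV by (simp add: real_vector.representation_scale[OF ind])
  qed
  then have "Matrix.mat n n (\<lambda>(i, j). representation (set as) (cs ! j) (as ! i)) = A * B"
    by (intro eq_matI) (auto simp: A_def B_def scalar_prod_def mult.commute atLeast0LessThan
        intro!: sum.cong)
  moreover have "Determinant.det (A * B) = Determinant.det A * Determinant.det B"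
    by (rule det_mult) (auto simp: A_def B_def)
  ultimately show ?thesis
    by (simp add: coord_det_def la A_def B_def flip: n_def)
qed

lemma coord_det_self:
  assumes "ordered_basis V bs"
  shows "coord_det bs bs = 1"
proof -
  have "Matrix.mat (length bs) (length bs)
      (\<lambda>(i, j). representation (set bs) (bs ! j) (bs ! i)) = 1\<^sub>m (length bs)"
    using assms by (intro eq_matI)
      (auto simp: ordered_basis_def real_vector.representation_basis nth_eq_iff_index_eq)
  then show ?thesis by (simp add: coord_det_def)
qed

lemma coord_det_inverse:
  fixes V :: "'a::euclidean_space set"
  assumes "ordered_basis V as" "ordered_basis V bs"
  shows "coord_det as bs * coord_det bs as = 1"
  using coord_det_mult[OF assms, of as] assms coord_det_self[OF assms(1)]
    ordered_basis_length[OF assms(1)] ordered_basis_length[OF assms(2)] real_vector.span_superset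
  by (fastforce simp: ordered_basis_def)

lemma representation_linear_image:
  assumes f: "linear f" "inj f" and B: "finite B" "independent B" and v: "v \<in> span B" and b: "b \<in> B"
  shows "representation (f ` B) (f v) (f b) = representation B v b"
proof -
  have ind: "independent (f ` B)"
    using f B(2) by (meson inj_on_subset real_vector.linear_independent_injective_image subset_UNIV)
  have "v = (\<Sum>x\<in>B. representation B v x *\<^sub>R x)"
    using real_vector.sum_representation_eq[OF B(2) v B(1)] by simp
  then have "f v = (\<Sum>x\<in>B. representation B v x *\<^sub>R f x)"
    using f(1) by (metis (mono_tags, lifting) linear_scale linear_sum sum.cong)
  then have "representation (f ` B) (f v) =
      representation (f ` B) (\<Sum>x\<in>B. representation B v x *\<^sub>R f x)"
    by simp
  then have "representation (f ` B) (f v) (f b) =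
      (\<Sum>x\<in>B. representation B v x * representation (f ` B) (f x) (f b))"
    by (simp add: real_vector.representation_sum[OF ind] real_vector.span_scale real_vector.span_base
          real_vector.representation_scale[OF ind])
  also have "\<dots> = (\<Sum>x\<in>B. if x = b then representation B v x else 0)"
    using f(2) by (intro sum.cong) (auto simp: real_vector.representation_basis[OF ind] inj_eq)
  also have "\<dots> = representation B v b" using B b by simp
  finally show ?thesis .
qed

lemma ordered_basis_map:
  assumes "linear f" "inj f" "ordered_basis V bs"
  shows "ordered_basis (f ` V) (map f bs)"
  using assms unfolding ordered_basis_def
  by (auto simp: distinct_map real_vector.linear_span_image inj_on_subset[OF _ subset_UNIV]
      dest: real_vector.linear_independent_injective_image)

lemma coord_det_map:
  assumes f: "linear f" "inj f" and bs: "ordered_basis V bs"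
    and cs: "length cs = length bs" "set cs \<subseteq> V"
  shows "coord_det (map f bs) (map f cs) = coord_det bs cs"
proof -
  have "representation (f ` set bs) (f (cs ! j)) (f (bs ! i)) = representation (set bs) (cs ! j) (bs ! i)"
    if "i < length bs" "j < length bs" for i j
    using bs cs that f by (intro representation_linear_image) (auto simp: ordered_basis_def)
  then show ?thesis
    using cs unfolding coord_det_def
    by (auto intro!: arg_cong[where f = Determinant.det] cong_mat)
qed

text \<open>
  The coordinate matrix is block triangular: \<open>cs\<close> has no component along \<open>v\<close>, and the last column ends
  in \<open>c\<close>. This is how an orientation of a hyperplane and a side of it determine an orientation of the
  whole space.
\<close>

lemma coord_det_snoc:
  assumes bs: "ordered_basis V bs" and v: "v \<notin> V"
    and cs: "length cs = length bs" "set cs \<subseteq> V" and h: "h \<in> V"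
  shows "coord_det (bs @ [v]) (cs @ [c *\<^sub>R v + h]) = coord_det bs cs * c"
proof -
  define n where "n = length bs"
  let ?B = "insert v (set bs)"
  have V: "V = span (set bs)" and ib: "independent (set bs)" and d: "distinct bs"
    using bs by (auto simp: ordered_basis_def)
  have vb: "v \<notin> set bs" using v V by (auto intro: real_vector.span_base)
  have ind: "independent ?B" using ib v V by (simp add: real_vector.independent_insertI)
  have r: "representation ?B x = representation (set bs) x" if "x \<in> V" for x
    using that V by (intro real_vector.representation_extend[OF ind]) auto
  have r0: "representation (set bs) x v = 0" for x
    using vb by (meson real_vector.representation_ne_zero)
  have rv: "representation ?B (c *\<^sub>R v + h) v = c"
  proof -
    have "v \<in> span ?B" "h \<in> span ?B"
      using h V real_vector.span_mono[of "set bs" ?B] by (auto intro: real_vector.span_base)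
    then show ?thesis
      by (simp add: real_vector.representation_add[OF ind] real_vector.span_scale
          real_vector.representation_scale[OF ind] r[OF h] r0 real_vector.representation_basis[OF ind])
  qed
  define A where "A = Matrix.mat n n (\<lambda>(i, j). representation (set bs) (cs ! j) (bs ! i))"
  define E where "E = Matrix.mat n 1 (\<lambda>(i, j). representation ?B (c *\<^sub>R v + h) (bs ! i))"
  define D where "D = Matrix.mat 1 1 (\<lambda>(i::nat, j::nat). c)"
  have cV: "cs ! j \<in> V" if "j < n" for j using cs that n_def by auto
  have "Matrix.mat (n + 1) (n + 1) (\<lambda>(i, j). representation ?B ((cs @ [c *\<^sub>R v + h]) ! j) ((bs @ [v]) ! i))
      = four_block_mat A E (0\<^sub>m 1 n) D"
    using cs by (intro eq_matI)
      (auto simp: A_def E_def D_def nth_append r cV r0 rv simp flip: n_def)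
  moreover have "Determinant.det (four_block_mat A E (0\<^sub>m 1 n) D) = Determinant.det A * Determinant.det D"
    by (rule det_four_block_mat_lower_left_zero) (auto simp: A_def E_def D_def)
  moreover have "Determinant.det D = c"
    by (simp add: D_def det_single)
  ultimately show ?thesis
    by (simp add: coord_det_def A_def flip: n_def)
qed

text \<open>
  The determinant of an endomorphism is invariant under conjugation by a change of basis, so the
  arbitrary basis chosen in the definition of \<open>det_on\<close> can be replaced by a convenient one.
\<close>

lemma det_on_eq:
  fixes V :: "'a::euclidean_space set"
  assumes f: "linear f" "inj f" "f ` V = V" and bs: "ordered_basis V bs"
  shows "det_on V f = coord_det bs (map f bs)"
proof -
  define cs where "cs = (SOME bs. ordered_basis V bs)"
  have cs: "ordered_basis V cs" unfolding cs_def using bs by (rule someI)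
  have l: "length cs = length bs" using ordered_basis_length[OF cs] ordered_basis_length[OF bs] by simp
  have sub: "set cs \<subseteq> V" "set bs \<subseteq> V"
    using bs cs real_vector.span_superset by (auto simp: ordered_basis_def)
  have fcs: "ordered_basis V (map f cs)" using ordered_basis_map[OF f(1,2) cs] f(3) by simp
  have fbs: "set (map f bs) \<subseteq> V" using sub f(3) by auto
  have "coord_det bs (map f bs) = coord_det bs cs * coord_det cs (map f bs)"
    using l fbs by (intro coord_det_mult[OF bs cs]) auto
  also have "coord_det cs (map f bs) = coord_det cs (map f cs) * coord_det (map f cs) (map f bs)"
    using l fbs by (intro coord_det_mult[OF cs fcs]) auto
  also have "coord_det (map f cs) (map f bs) = coord_det cs bs"
    using l sub by (intro coord_det_map[OF f(1,2) cs]) auto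
  finally show ?thesis
    using coord_det_inverse[OF bs cs]
    by (simp add: det_on_def Let_def flip: cs_def)
qed

definition std_basis :: "'n::{finite,linorder} rvec list" where
  "std_basis = map (\<lambda>i. axis i 1) (sorted_list_of_set (UNIV :: 'n set))"

lemma ordered_basis_std: "ordered_basis UNIV (std_basis :: 'n::{finite,linorder} rvec list)"
proof -
  have "set (std_basis :: 'n rvec list) = Basis"
    by (auto simp: std_basis_def Basis_vec_def)
  moreover have "distinct (std_basis :: 'n rvec list)"
    by (auto simp: std_basis_def distinct_map inj_on_def axis_eq_axis)
  ultimately show ?thesis
    by (simp add: ordered_basis_def independent_Basis)
qed

lemma representation_Basis:
  fixes x :: "'a::euclidean_space"
  assumes "b \<in> Basis"
  shows "representation Basis x b = x \<bullet> b"
proof -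
  have "representation Basis x = (\<lambda>b. if b \<in> Basis then x \<bullet> b else 0)"
  proof (rule real_vector.representation_eqI)
    have "(\<Sum>b | (if b \<in> Basis then x \<bullet> b else 0) \<noteq> 0. (if b \<in> Basis then x \<bullet> b else 0) *\<^sub>R b)
       = (\<Sum>b\<in>Basis. (x \<bullet> b) *\<^sub>R b)"
      by (rule sum.mono_neutral_cong_left) auto
    then show "(\<Sum>b | (if b \<in> Basis then x \<bullet> b else 0) \<noteq> 0. (if b \<in> Basis then x \<bullet> b else 0) *\<^sub>R b) = x"
      by (simp add: euclidean_representation)
  qed (auto simp: independent_Basis split: if_splits)
  with assms show ?thesis by simp
qed

text \<open>
  The two determinants are the same Leibniz sum, once over permutations of \<open>{0..<n}\<close> and once over
  permutations of the index type; enumerating the index type in increasing order identifies them.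
\<close>

lemma coord_det_std_map:
  fixes f :: "'n::{finite,linorder} rvec \<Rightarrow> 'n rvec"
  shows "coord_det std_basis (map f std_basis) = Determinants.det (matrix f)"
proof -
  define xs where "xs = sorted_list_of_set (UNIV :: 'n set)"
  define n where "n = length xs"
  have sx: "set xs = UNIV" "distinct xs" by (simp_all add: xs_def)
  have bij: "bij_betw (nth xs) {0..<n} UNIV"
    using bij_betw_nth[OF sx(2)] sx(1) n_def atLeast0LessThan by auto
  define M where "M = matrix f"
  have sB: "set (std_basis :: 'n rvec list) = Basis"
    by (auto simp: std_basis_def Basis_vec_def)
  have ls: "length (std_basis :: 'n rvec list) = n" by (simp add: std_basis_def n_def xs_def)
  have in_Basis: "axis i 1 \<in> (Basis :: 'n rvec set)" for i by (auto simp: Basis_vec_def)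
  have e: "representation (set std_basis) (map f std_basis ! j) (std_basis ! i) =
      vec_nth (vec_nth M (xs ! i)) (xs ! j)" if "i < n" "j < n" for i j
    using that unfolding sB
    by (subst representation_Basis)
      (simp_all add: in_Basis std_basis_def n_def M_def matrix_def inner_axis flip: xs_def)
  have "coord_det std_basis (map f std_basis) =
      Determinant.det (Matrix.mat n n (\<lambda>(i, j). vec_nth (vec_nth M (xs ! i)) (xs ! j)))"
    unfolding coord_det_def
    by (rule arg_cong[where f = Determinant.det])
      (auto simp: ls e simp del: nth_map intro!: cong_mat)
  also have "\<dots> = (\<Sum>p | p permutes {0..<n}. of_int (sign p) *
      (\<Prod>i = 0..<n. vec_nth (vec_nth M (xs ! i)) (xs ! p i)))"
    by (subst det_def'[where n = n]) (auto simp: permutes_in_image intro!: sum.cong prod.cong)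
  also have "\<dots> = (\<Sum>p | p permutes {0..<n}.
      of_int (sign (map_permutation {0..<n} (nth xs) p)) *
      (\<Prod>i\<in>UNIV. vec_nth (vec_nth M i) (map_permutation {0..<n} (nth xs) p i)))"
  proof (intro sum.cong refl, clarify)
    fix p assume p: "p permutes {0..<n}"
    have inj: "inj_on (nth xs) {0..<n}" using bij by (simp add: bij_betw_def)
    have "(\<Prod>i = 0..<n. vec_nth (vec_nth M (xs ! i)) (xs ! p i)) =
        (\<Prod>i = 0..<n. vec_nth (vec_nth M (xs ! i)) (map_permutation {0..<n} (nth xs) p (xs ! i)))"
      by (intro prod.cong refl) (simp add: map_permutation_apply[OF inj])
    also have "\<dots> = (\<Prod>i\<in>UNIV. vec_nth (vec_nth M i) (map_permutation {0..<n} (nth xs) p i))"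
      by (rule prod.reindex_bij_betw[OF bij])
    finally show "of_int (sign p) * (\<Prod>i = 0..<n. vec_nth (vec_nth M (xs ! i)) (xs ! p i)) =
        of_int (sign (map_permutation {0..<n} (nth xs) p)) *
      (\<Prod>i\<in>UNIV. vec_nth (vec_nth M i) (map_permutation {0..<n} (nth xs) p i))"
      using sign_map_permutation[OF inj p] by simp
  qed
  also have "\<dots> = (\<Sum>p | p permutes UNIV. of_int (sign p) * (\<Prod>i\<in>UNIV. vec_nth (vec_nth M i) (p i)))"
  proof (rule sum.reindex_bij_betw[where h = "map_permutation {0..<n} (nth xs)"])
    let ?g = "inv_into {0..<n} (nth xs)"
    have bi: "bij_betw ?g UNIV {0..<n}" using bij by (rule bij_betw_inv_into)
    show "bij_betw (map_permutation {0..<n} (nth xs)) {p. p permutes {0..<n}} {p. p permutes UNIV}"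
    proof (rule bij_betw_byWitness[where f' = "map_permutation UNIV ?g"])
      show "\<forall>p\<in>{p. p permutes {0..<n}}. map_permutation UNIV ?g (map_permutation {0..<n} (nth xs) p) = p"
        using map_permutation_compose_inv[OF bij] bij_betw_inv_into_left[OF bij] by auto
      show "\<forall>p\<in>{p. p permutes UNIV}. map_permutation {0..<n} (nth xs) (map_permutation UNIV ?g p) = p"
        using map_permutation_compose_inv[OF bi] bij_betw_inv_into_right[OF bij] by auto
      show "map_permutation {0..<n} (nth xs) ` {p. p permutes {0..<n}} \<subseteq> {p. p permutes UNIV}"
        using map_permutation_permutes[OF bij] by auto
      show "map_permutation UNIV ?g ` {p. p permutes UNIV} \<subseteq> {p. p permutes {0..<n}}"
        using map_permutation_permutes[OF bi] by auto
    qed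
  qed
  finally show ?thesis by (simp add: Determinants.det_def M_def)
qed

section \<open>Polyhedral cones and their facets\<close>

definition full_cone :: "'a::euclidean_space set \<Rightarrow> bool" where
  "full_cone \<sigma> \<longleftrightarrow> polyhedral_cone \<sigma> \<and> aff_dim \<sigma> = int DIM('a)"

lemma polyhedral_coneD:
  assumes "polyhedral_cone \<sigma>"
  shows "convex \<sigma>" "closed \<sigma>" "0 \<in> \<sigma>" "conic \<sigma>" "polyhedron \<sigma>"
    and "\<And>c x. x \<in> \<sigma> \<Longrightarrow> 0 \<le> c \<Longrightarrow> c *\<^sub>R x \<in> \<sigma>"
    and "\<And>x y. x \<in> \<sigma> \<Longrightarrow> y \<in> \<sigma> \<Longrightarrow> x + y \<in> \<sigma>"
proof -
  have p: "polyhedron \<sigma>" and c: "cone \<sigma>" and ne: "\<sigma> \<noteq> {}"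
    using assms by (auto simp: polyhedral_cone_def)
  show conv: "convex \<sigma>" using p by (rule polyhedron_imp_convex)
  show "closed \<sigma>" using p by (rule polyhedron_imp_closed)
  show "0 \<in> \<sigma>" using c ne cone_contains_0 by blast
  show "conic \<sigma>" using c by (auto simp: conic_def cone_def)
  show "polyhedron \<sigma>" by (rule p)
  show "c *\<^sub>R x \<in> \<sigma>" if "x \<in> \<sigma>" "0 \<le> c" for c x using c that by (auto simp: cone_def)
  show "x + y \<in> \<sigma>" if "x \<in> \<sigma>" "y \<in> \<sigma>" for x y
    using convex_cone[of \<sigma>] conv c that by blast
qed

lemma polyhedral_cone_face:
  assumes "polyhedral_cone \<sigma>" "F face_of \<sigma>" "F \<noteq> {}"
  shows "polyhedral_cone F"
  using assms face_of_conic[of \<sigma> F] face_of_polyhedron_polyhedron[of \<sigma> F]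
    polyhedral_coneD[OF assms(1)]
  by (auto simp: polyhedral_cone_def conic_def cone_def)

lemma full_cone_interior:
  assumes "full_cone \<sigma>"
  shows "interior \<sigma> \<noteq> {}" "\<sigma> \<subseteq> closure (interior \<sigma>)"
proof -
  have c: "convex \<sigma>" using assms polyhedral_coneD by (auto simp: full_cone_def)
  have "\<sigma> \<noteq> {}" using assms by (auto simp: full_cone_def polyhedral_cone_def)
  then show i: "interior \<sigma> \<noteq> {}"
    using assms c rel_interior_eq_empty[of \<sigma>] by (simp add: full_cone_def interior_rel_interior_gen)
  show "\<sigma> \<subseteq> closure (interior \<sigma>)"
    using convex_closure_interior[OF c i] closure_subset by auto
qed

text \<open>
  A full-dimensional closed cone is the closure of its interior, so an open set that meets it also
  meets its interior. This makes a tile the only one that contains any of its interior points.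
\<close>

lemma full_cone_interior_meets:
  assumes "full_cone \<sigma>'" "interior \<sigma> \<inter> \<sigma>' \<noteq> {}"
  shows "interior \<sigma> \<inter> interior \<sigma>' \<noteq> {}"
  using assms full_cone_interior(2)[OF assms(1)] open_Int_closure_eq_empty[OF open_interior, of \<sigma> "interior \<sigma>'"]
  by blast

lemma polyhedral_cone_add_interior:
  assumes "polyhedral_cone \<sigma>" "p \<in> \<sigma>" "w \<in> interior \<sigma>" "t > 0"
  shows "p + t *\<^sub>R w \<in> interior \<sigma>"
proof -
  let ?U = "(\<lambda>x. p + t *\<^sub>R x) ` interior \<sigma>"
  have "open ?U" using assms(4) by (intro open_affinity) auto
  moreover have "?U \<subseteq> \<sigma>"
  proof clarify
    fix x assume "x \<in> interior \<sigma>"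
    then have "t *\<^sub>R x \<in> \<sigma>"
      using assms(4) interior_subset[of \<sigma>] by (intro polyhedral_coneD(6)[OF assms(1)]) auto
    then show "p + t *\<^sub>R x \<in> \<sigma>" by (rule polyhedral_coneD(7)[OF assms(1,2)])
  qed
  ultimately show ?thesis using assms(3) by (meson image_eqI interior_maximal subsetD)
qed

lemma facet_hyperplane:
  fixes \<sigma> :: "'a::euclidean_space set"
  assumes \<sigma>: "full_cone \<sigma>" and \<tau>: "\<tau> facet_of \<sigma>"
  obtains a where "a \<noteq> 0" "\<sigma> \<subseteq> {x. a \<bullet> x \<le> 0}" "\<tau> = \<sigma> \<inter> {x. a \<bullet> x = 0}" "span \<tau> = {x. a \<bullet> x = 0}"
proof -
  have pc: "polyhedral_cone \<sigma>" and ad: "aff_dim \<sigma> = int DIM('a)" using \<sigma> by (auto simp: full_cone_def)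
  obtain a b where ab: "a \<noteq> 0" "\<sigma> \<subseteq> {x. a \<bullet> x \<le> b}" "\<tau> = \<sigma> \<inter> {x. a \<bullet> x = b}"
    using facet_of_polyhedron[OF polyhedral_coneD(5)[OF pc] \<tau>] by blast
  have "polyhedral_cone \<tau>" using polyhedral_cone_face[OF pc] \<tau> by (auto simp: facet_of_def)
  then have 0: "0 \<in> \<tau>" by (rule polyhedral_coneD)
  then have b: "b = 0" using ab by auto
  have "int (dim \<tau>) = int DIM('a) - 1"
    using \<tau> ad 0 by (simp add: facet_of_def aff_dim_zero hull_inc)
  then have "dim (span \<tau>) = dim {x. a \<bullet> x = 0}"
    using dim_hyperplane[OF ab(1)] by (simp add: of_nat_diff)
  moreover have "span \<tau> \<subseteq> {x. a \<bullet> x = 0}"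
    using ab b by (intro real_vector.span_minimal) (auto simp: subspace_hyperplane)
  ultimately have "span \<tau> = {x. a \<bullet> x = 0}"
    using subspace_dim_equal[OF real_vector.subspace_span subspace_hyperplane] by fastforce
  then show ?thesis using that ab b by blast
qed

lemma facet_proper:
  assumes "\<tau> facet_of \<sigma>"
  shows "\<tau> \<subseteq> \<sigma>" "\<tau> \<noteq> \<sigma>" "\<exists>v. v \<in> \<sigma> \<and> v \<notin> \<tau>"
proof -
  show "\<tau> \<subseteq> \<sigma>" "\<tau> \<noteq> \<sigma>" using assms facet_of_imp_subset facet_of_irrefl by blast+
  then show "\<exists>v. v \<in> \<sigma> \<and> v \<notin> \<tau>" by blast
qed

text \<open>
  Close to a relative interior point of a facet, the cone is the whole half-space bounded by the
  facet: write \<open>w = c v + h\<close> with \<open>v\<close> in the cone, \<open>c \<ge> 0\<close> and \<open>h\<close> in the span of the facet; small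
  multiples of \<open>h\<close> do not leave the facet.
\<close>

lemma facet_add_direction:
  fixes \<sigma> :: "'a::euclidean_space set"
  assumes \<sigma>: "full_cone \<sigma>" and \<tau>: "\<tau> facet_of \<sigma>"
    and a: "\<sigma> \<subseteq> {x. a \<bullet> x \<le> 0}" "\<tau> = \<sigma> \<inter> {x. a \<bullet> x = 0}" "span \<tau> = {x. a \<bullet> x = 0}"
    and p: "p \<in> rel_interior \<tau>" and w: "a \<bullet> w \<le> 0"
  obtains e where "e > 0" "\<And>t. 0 < t \<Longrightarrow> t \<le> e \<Longrightarrow> p + t *\<^sub>R w \<in> \<sigma>"
proof -
  have pc: "polyhedral_cone \<sigma>" using \<sigma> by (auto simp: full_cone_def)
  obtain v where v: "v \<in> \<sigma>" "v \<notin> \<tau>" using facet_proper[OF \<tau>] by blast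
  then have av: "a \<bullet> v < 0" using a by force
  define c where "c = (a \<bullet> w) / (a \<bullet> v)"
  have c: "c \<ge> 0" using w av by (simp add: c_def divide_nonpos_neg)
  define h where "h = w - c *\<^sub>R v"
  have h: "h \<in> span \<tau>" using av a(3) by (simp add: h_def inner_diff_right c_def)
  have "polyhedral_cone \<tau>" using polyhedral_cone_face[OF pc] \<tau> by (auto simp: facet_of_def)
  then have "0 \<in> \<tau>" by (rule polyhedral_coneD)
  then have aff: "affine hull \<tau> = span \<tau>" by (simp add: affine_hull_span_0 hull_inc)
  obtain d where d: "d > 0" "cball p d \<inter> affine hull \<tau> \<subseteq> \<tau>" and pt: "p \<in> \<tau>"
    using p by (auto simp: mem_rel_interior_cball)
  define e where "e = d / (norm h + 1)"
  have e: "e > 0" using d by (simp add: e_def add_nonneg_pos)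
  have "p + t *\<^sub>R w \<in> \<sigma>" if t: "0 < t" "t \<le> e" for t
  proof -
    have "t * norm h \<le> e * (norm h + 1)" using t e by (intro mult_mono) auto
    also have "\<dots> = d" by (simp add: e_def add_nonneg_eq_0_iff)
    finally have "p + t *\<^sub>R h \<in> cball p d" using t by (simp add: dist_norm)
    moreover have "p + t *\<^sub>R h \<in> span \<tau>"
      using pt h by (simp add: real_vector.span_add real_vector.span_base real_vector.span_scale)
    ultimately have "p + t *\<^sub>R h \<in> \<tau>" using d(2) aff by auto
    then have "p + t *\<^sub>R h \<in> \<sigma>" using facet_proper(1)[OF \<tau>] by blast
    moreover have "(t * c) *\<^sub>R v \<in> \<sigma>" using v t c by (intro polyhedral_coneD(6)[OF pc]) auto
    ultimately have "p + t *\<^sub>R h + (t * c) *\<^sub>R v \<in> \<sigma>" by (rule polyhedral_coneD(7)[OF pc])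
    then show ?thesis by (simp add: h_def algebra_simps)
  qed
  with e show ?thesis by (rule that)
qed

text \<open>
  If both cones were on the same side of the common facet, each would be the full half-space near a
  relative interior point of it, and the interiors would meet.
\<close>

lemma facet_opposite_sides:
  fixes \<sigma> \<sigma>' :: "'a::euclidean_space set"
  assumes \<sigma>: "full_cone \<sigma>" "\<tau> facet_of \<sigma>" and \<sigma>': "full_cone \<sigma>'" "\<tau> facet_of \<sigma>'"
    and disj: "interior \<sigma> \<inter> interior \<sigma>' = {}"
  obtains a where "a \<noteq> 0" "\<sigma> \<subseteq> {x. a \<bullet> x \<le> 0}" "\<tau> = \<sigma> \<inter> {x. a \<bullet> x = 0}"
    "\<sigma>' \<subseteq> {x. (- a) \<bullet> x \<le> 0}" "\<tau> = \<sigma>' \<inter> {x. (- a) \<bullet> x = 0}" "span \<tau> = {x. a \<bullet> x = 0}"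
proof -
  obtain a where a: "a \<noteq> 0" "\<sigma> \<subseteq> {x. a \<bullet> x \<le> 0}" "\<tau> = \<sigma> \<inter> {x. a \<bullet> x = 0}" "span \<tau> = {x. a \<bullet> x = 0}"
    using facet_hyperplane[OF \<sigma>] .
  obtain a' where a': "a' \<noteq> 0" "\<sigma>' \<subseteq> {x. a' \<bullet> x \<le> 0}" "\<tau> = \<sigma>' \<inter> {x. a' \<bullet> x = 0}"
      "span \<tau> = {x. a' \<bullet> x = 0}"
    using facet_hyperplane[OF \<sigma>'] .
  \<comment> \<open>Both normals are orthogonal to the span of \<open>\<tau>\<close>, hence proportional; \<open>d\<close> is the part of \<open>a'\<close>
    orthogonal to \<open>a\<close>.\<close>
  define k where "k = (a \<bullet> a') / (a \<bullet> a)"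
  define d where "d = a' - k *\<^sub>R a"
  have "a \<bullet> d = 0" using a(1) by (simp add: d_def k_def inner_diff_right)
  then have "a' \<bullet> d = 0" using a(4) a'(4) by blast
  with \<open>a \<bullet> d = 0\<close> have "d \<bullet> d = 0" by (simp add: d_def inner_diff_left)
  then have k: "a' = k *\<^sub>R a" by (simp add: d_def)
  then have "k \<noteq> 0" using a' by auto
  moreover have "\<not> k > 0"
  proof
    assume "k > 0"
    have "convex \<tau>" "\<tau> \<noteq> {}" using \<sigma>(2) face_of_imp_convex by (auto simp: facet_of_def)
    then obtain p where p: "p \<in> rel_interior \<tau>" using rel_interior_eq_empty by blast
    obtain w where w: "w \<in> interior \<sigma>" using full_cone_interior[OF \<sigma>(1)] by blast
    then have "a \<bullet> w \<le> 0" using a interior_subset by blast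
    then have "a' \<bullet> w \<le> 0" using k \<open>k > 0\<close> by (simp add: mult_nonneg_nonpos)
    then obtain e where "e > 0" "\<And>t. 0 < t \<Longrightarrow> t \<le> e \<Longrightarrow> p + t *\<^sub>R w \<in> \<sigma>'"
      using facet_add_direction[OF \<sigma>' a'(2,3,4) p] by blast
    then have "p + e *\<^sub>R w \<in> \<sigma>'" by simp
    moreover have "p + e *\<^sub>R w \<in> interior \<sigma>"
      using \<open>e > 0\<close> w p rel_interior_subset[of \<tau>] facet_proper(1)[OF \<sigma>(2)] \<sigma>(1)
      by (intro polyhedral_cone_add_interior) (auto simp: full_cone_def)
    ultimately show False using full_cone_interior_meets[OF \<sigma>'(1)] disj by blast
  qed
  ultimately have "k < 0" by simp
  then have "\<sigma>' \<subseteq> {x. (- a) \<bullet> x \<le> 0}" "\<tau> = \<sigma>' \<inter> {x. (- a) \<bullet> x = 0}"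
    using a'(2,3) k by (auto simp: mult_le_0_iff)
  then show ?thesis by (rule that[OF a(1-3) _ _ a(4)])
qed

text \<open>
  A ray in direction \<open>- y\<close> that stayed in the closed cone forever would have its direction in the
  cone. So there is a last point in the cone, and it lies on the relative boundary.
\<close>

lemma cone_exit:
  assumes F: "polyhedral_cone F" and x: "x \<in> F" and y: "y \<in> F" "- y \<notin> F"
  obtains t where "t \<ge> 0" "x - t *\<^sub>R y \<in> rel_frontier F"
proof -
  note FD = polyhedral_coneD[OF F]
  define K where "K = {t. 0 \<le> t \<and> x - t *\<^sub>R y \<in> F}"
  have "\<exists>N. \<forall>t\<in>K. t \<le> N"
  proof (rule ccontr)
    assume "\<nexists>N. \<forall>t\<in>K. t \<le> N"
    then have "\<not> (\<forall>t\<in>K. t \<le> real (Suc n))" for n by blast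
    then have n: "\<exists>t\<in>K. real (Suc n) < t" for n by (auto simp: not_le simp del: of_nat_Suc)
    have "inverse (real (Suc n)) *\<^sub>R x - y \<in> F" for n
    proof -
      obtain t where "t \<in> K" "real (Suc n) < t" using n by blast
      then have "x - t *\<^sub>R y + (t - real (Suc n)) *\<^sub>R y \<in> F"
        using y(1) unfolding K_def by (intro FD(7) FD(6)[of y]) auto
      then have "x - real (Suc n) *\<^sub>R y \<in> F"
        by (simp only: scaleR_left_diff_distrib add_diff_eq diff_add_cancel)
      then have "inverse (real (Suc n)) *\<^sub>R (x - real (Suc n) *\<^sub>R y) \<in> F"
        by (intro FD(6)) auto
      then show ?thesis by (simp add: scaleR_diff_right del: of_nat_Suc)
    qed
    moreover have "(\<lambda>n. inverse (real (Suc n)) *\<^sub>R x - y) \<longlonglongrightarrow> 0 *\<^sub>R x - y"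
      by (intro tendsto_intros LIMSEQ_inverse_real_of_nat)
    ultimately have "0 *\<^sub>R x - y \<in> F"
      by (rule closed_sequentially[OF FD(2)])
    then show False using y by simp
  qed
  then obtain N where "\<forall>t\<in>K. t \<le> N" by blast
  then have "K \<subseteq> {0..N}" by (auto simp: K_def)
  moreover have "closed K"
  proof -
    have "K = {0..} \<inter> (\<lambda>t. x - t *\<^sub>R y) -` F" by (auto simp: K_def)
    then show ?thesis
      by (auto intro!: closed_Int continuous_closed_vimage FD continuous_intros)
  qed
  ultimately have "compact K" by (meson bounded_closed_interval bounded_subset compact_eq_bounded_closed)
  moreover have "0 \<in> K" using x by (simp add: K_def)
  ultimately obtain t where t: "t \<in> K" "\<And>s. s \<in> K \<Longrightarrow> s \<le> t"
    using compact_attains_sup[of K] by blast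
  have "x - t *\<^sub>R y \<notin> rel_interior F"
  proof
    assume "x - t *\<^sub>R y \<in> rel_interior F"
    then obtain d where d: "d > 0" "cball (x - t *\<^sub>R y) d \<inter> affine hull F \<subseteq> F"
      by (auto simp: mem_rel_interior_cball)
    define e where "e = d / (norm y + 1)"
    have e: "e > 0" using d by (simp add: e_def add_nonneg_pos)
    have "e * norm y \<le> e * (norm y + 1)" using e by simp
    also have "\<dots> = d" by (simp add: e_def add_nonneg_eq_0_iff)
    finally have "x - (t + e) *\<^sub>R y \<in> cball (x - t *\<^sub>R y) d"
      using e by (simp add: dist_norm algebra_simps)
    moreover have "x - (t + e) *\<^sub>R y \<in> affine hull F"
      using FD(3) x y by (simp add: affine_hull_span_0 hull_inc real_vector.span_diff real_vector.span_scale real_vector.span_base)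
    ultimately have "t + e \<in> K" using d(2) t(1) e by (auto simp: K_def)
    then show False using t(2) e by fastforce
  qed
  then have "x - t *\<^sub>R y \<in> rel_frontier F"
    using t(1) FD(2) by (auto simp: rel_frontier_def K_def)
  then show ?thesis using t(1) by (intro that[of t]) (auto simp: K_def)
qed

text \<open>
  Existence of the vector \<open>v\<close> in the definition of \<open>\<epsilon>\<close>. Among the faces not contained in \<open>\<tau>\<close>, one of
  minimal dimension has its relative boundary in \<open>\<tau>\<close>. Such a face \<open>F\<close> is the ray through any
  \<open>x \<in> F - \<tau>\<close>: for \<open>y \<in> F\<close> walk from \<open>x\<close> against \<open>y\<close> and from \<open>y\<close> against \<open>x\<close> until the boundary;
  unless \<open>y\<close> is a multiple of \<open>x\<close>, this writes \<open>x\<close> as a nonnegative combination of points of \<open>\<tau>\<close>.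
\<close>

lemma extreme_ray_avoiding:
  assumes \<sigma>: "polyhedral_cone \<sigma>" and pointed: "\<And>x. x \<in> \<sigma> \<Longrightarrow> - x \<in> \<sigma> \<Longrightarrow> x = 0"
    and \<tau>: "polyhedral_cone \<tau>" "\<not> \<sigma> \<subseteq> \<tau>"
  obtains v where "extreme_ray_generator \<sigma> v" "v \<notin> \<tau>"
proof -
  note TD = polyhedral_coneD[OF \<tau>(1)]
  have "\<sigma> face_of \<sigma> \<and> \<not> \<sigma> \<subseteq> \<tau>" using \<tau>(2) polyhedral_coneD(1)[OF \<sigma>] face_of_refl by blast
  then obtain F where F: "F face_of \<sigma>" "\<not> F \<subseteq> \<tau>"
    and min: "\<And>F'. F' face_of \<sigma> \<Longrightarrow> \<not> F' \<subseteq> \<tau> \<Longrightarrow> nat (aff_dim F) \<le> nat (aff_dim F')"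
    using ex_has_least_nat[of "\<lambda>F. F face_of \<sigma> \<and> \<not> F \<subseteq> \<tau>" \<sigma> "\<lambda>F. nat (aff_dim F)"] by blast
  \<comment> \<open>Truncation by \<open>nat\<close> only identifies the dimensions \<open>- 1\<close> and \<open>0\<close>; facets are nonempty, so
    the dimension still drops from \<open>F\<close> to its facets.\<close>
  have pF: "polyhedral_cone F" using F by (intro polyhedral_cone_face[OF \<sigma>]) auto
  note FD = polyhedral_coneD[OF pF]
  have sub: "F \<subseteq> \<sigma>" using F(1) by (rule face_of_imp_subset)
  have "F' \<subseteq> \<tau>" if "F' facet_of F" for F'
  proof (rule ccontr)
    assume "\<not> F' \<subseteq> \<tau>"
    then have "nat (aff_dim F) \<le> nat (aff_dim F')"
      using min face_of_trans[OF facet_of_imp_face_of[OF that] F(1)] by blast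
    moreover have "aff_dim F' \<noteq> - 1" "aff_dim F' = aff_dim F - 1"
      using that aff_dim_empty[of F'] by (auto simp: facet_of_def)
    moreover have "aff_dim F' \<ge> - 1" by (rule aff_dim_geq)
    ultimately show False by linarith
  qed
  then have front: "rel_frontier F \<subseteq> \<tau>" using rel_frontier_of_polyhedron[OF FD(5)] by auto
  obtain x where x: "x \<in> F" "x \<notin> \<tau>" using F by blast
  have x0: "x \<noteq> 0" using x TD(3) by auto
  have pt: "u = 0" if "u \<in> F" "- u \<in> F" for u using pointed that sub by blast
  have "y \<in> {c *\<^sub>R x |c. c \<ge> 0}" if y: "y \<in> F" for y
  proof (cases "y = 0")
    case True
    then show ?thesis by (auto intro!: exI[of _ 0])
  next
    case False
    obtain t where t: "t \<ge> 0" "x - t *\<^sub>R y \<in> rel_frontier F"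
      using cone_exit[OF pF x(1) y] pt[OF y] False by blast
    obtain s where s: "s \<ge> 0" "y - s *\<^sub>R x \<in> rel_frontier F"
      using cone_exit[OF pF y x(1)] pt[OF x(1)] x0 by blast
    define z u where "z = x - t *\<^sub>R y" and "u = y - s *\<^sub>R x"
    have zu: "z \<in> \<tau>" "u \<in> \<tau>" "z \<in> F" "u \<in> F"
      using t s front FD(2) by (auto simp: z_def u_def rel_frontier_def)
    have e: "(1 - t * s) *\<^sub>R x = z + t *\<^sub>R u" by (simp add: z_def u_def algebra_simps)
    have "\<not> t * s < 1"
    proof
      assume ts: "t * s < 1"
      have "inverse (1 - t * s) *\<^sub>R (z + t *\<^sub>R u) \<in> \<tau>" using zu t ts by (intro TD(6) TD(7)) auto
      then have "x \<in> \<tau>" using ts by (simp flip: e)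
      then show False using x by simp
    qed
    then have "t *\<^sub>R u + (t * s - 1) *\<^sub>R x \<in> F" using zu t x
      by (intro FD(6) FD(7)) auto
    moreover have "- z = t *\<^sub>R u + (t * s - 1) *\<^sub>R x" using e by (simp add: algebra_simps)
    ultimately have "z = 0" using pt zu by simp
    then have xt: "x = t *\<^sub>R y" by (simp add: z_def)
    then have "t \<noteq> 0" using x0 by auto
    then show ?thesis using xt t by (auto intro!: exI[of _ "inverse t"])
  qed
  moreover have "{c *\<^sub>R x |c. c \<ge> 0} \<subseteq> F" using x FD(6) by auto
  ultimately have "F = {c *\<^sub>R x |c. c \<ge> 0}" by blast
  then have "extreme_ray_generator \<sigma> x" using F x0 by (simp add: extreme_ray_generator_def)
  then show ?thesis using x(2) by (rule that)
qed

lemma contains_no_lines_pointed: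
  assumes "contains_no_lines A" "cone \<sigma>" "\<sigma> \<subseteq> A" "x \<in> \<sigma>" "- x \<in> \<sigma>"
  shows "x = 0"
proof (rule ccontr)
  assume x: "x \<noteq> 0"
  have "c *\<^sub>R x \<in> \<sigma>" for c
  proof (cases "c \<ge> 0")
    case False
    then have "(- c) *\<^sub>R (- x) \<in> \<sigma>" using assms by (intro mem_cone[of \<sigma>]) auto
    then show ?thesis by simp
  qed (use assms in \<open>auto intro: mem_cone\<close>)
  then have "span {x} \<subseteq> A" using assms(3) by (auto simp: real_vector.span_singleton)
  moreover have "affine (span {x})" by (simp add: subspace_imp_affine)
  moreover have "aff_dim (span {x}) = 1"
    using x by (simp add: aff_dim_subspace)
  ultimately show False using assms(1) by (auto simp: contains_no_lines_def)
qed

section \<open>Connectedness of a tessellation through facets\<close>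

locale cone_tessellation =
  fixes C :: "'a::euclidean_space set" and T :: "'a set set"
  assumes open_C: "open C" and convex_C: "convex C"
    and tile: "\<And>\<sigma>. \<sigma> \<in> T \<Longrightarrow> full_cone \<sigma>" "\<And>\<sigma>. \<sigma> \<in> T \<Longrightarrow> \<sigma> \<subseteq> closure C"
    and tiles_disjoint: "\<And>\<sigma> \<sigma>'. \<sigma> \<in> T \<Longrightarrow> \<sigma>' \<in> T \<Longrightarrow> \<sigma> \<noteq> \<sigma>' \<Longrightarrow> interior \<sigma> \<inter> interior \<sigma>' = {}"
    and cover: "C \<subseteq> \<Union>T"
    and locally_finite: "locally_finite_on C T"
    and two_tiles: "\<And>\<tau>. \<tau> \<in> codim1_faces T \<Longrightarrow> card {\<sigma> \<in> T. \<tau> \<in> facets \<sigma>} = 2"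
begin

lemma tile_polyhedral: "\<sigma> \<in> T \<Longrightarrow> polyhedral_cone \<sigma>"
  using tile(1) by (simp add: full_cone_def)

lemma interior_tile_subset: "\<sigma> \<in> T \<Longrightarrow> interior \<sigma> \<subseteq> C"
  using interior_mono[OF tile(2)] convex_interior_closure[OF convex_C] interior_open[OF open_C] by blast

lemma tile_eqI:
  assumes "\<sigma> \<in> T" "\<rho> \<in> T" "p \<in> interior \<sigma>" "p \<in> \<rho>"
  shows "\<sigma> = \<rho>"
  using full_cone_interior_meets[OF tile(1)[OF assms(2)], of \<sigma>] tiles_disjoint[OF assms(1,2)] assms(3,4)
  by blast

lemma countable_tiles: "countable T"
proof -
  have inj: "inj_on interior T"
    using full_cone_interior(1)[OF tile(1)] tiles_disjoint unfolding inj_on_def by (metis Int_absorb)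
  have "disjoint (interior ` T)"
    using tiles_disjoint unfolding pairwise_def disjnt_def by blast
  then have "countable (interior ` T)"
    by (intro countable_disjoint_open_subsets) auto
  then show ?thesis using countable_image_inj_on[OF _ inj] by blast
qed

text \<open>
  By local finiteness, unions of tiles are relatively closed in \<open>C\<close>.
\<close>

lemma in_closure_Union_tiles:
  assumes "M \<subseteq> T" "z \<in> C" "z \<in> closure (\<Union>M)"
  shows "z \<in> \<Union>M"
proof -
  obtain U where U: "open U" "z \<in> U" "finite {\<sigma> \<in> T. \<sigma> \<inter> U \<noteq> {}}"
    using locally_finite assms(2) unfolding locally_finite_on_def by blast
  define N where "N = {\<sigma> \<in> M. \<sigma> \<inter> U \<noteq> {}}"
  have "finite N" using U(3) assms(1) unfolding N_def by (auto elim: rev_finite_subset)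
  moreover have "closed \<sigma>" if "\<sigma> \<in> N" for \<sigma>
    using that assms(1) tile_polyhedral polyhedral_coneD(2) unfolding N_def by blast
  ultimately have "closed (\<Union>N)" by blast
  moreover have "z \<in> closure (\<Union>N)"
  proof -
    have "z \<in> U \<inter> closure (\<Union>M)" using U assms by blast
    then have "z \<in> closure (U \<inter> \<Union>M)" using open_Int_closure_subset[OF U(1)] by blast
    moreover have "U \<inter> \<Union>M \<subseteq> \<Union>N" by (auto simp: N_def)
    ultimately show ?thesis using closure_mono by blast
  qed
  ultimately show ?thesis by (auto simp: closure_closed N_def)
qed

lemma facet_two_tiles:
  assumes "\<sigma> \<in> T" "\<tau> facet_of \<sigma>"
  obtains \<sigma>' where "\<sigma>' \<noteq> \<sigma>" "\<sigma>' \<in> T" "\<tau> facet_of \<sigma>'" "{\<rho> \<in> T. \<tau> facet_of \<rho>} = {\<sigma>, \<sigma>'}"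
proof -
  have "card {\<rho> \<in> T. \<tau> facet_of \<rho>} = 2"
    using two_tiles[of \<tau>] assms by (auto simp: codim1_faces_def facets_def)
  then obtain x y where xy: "{\<rho> \<in> T. \<tau> facet_of \<rho>} = {x, y}" "x \<noteq> y" by (auto simp: card_2_iff)
  moreover have "\<sigma> \<in> {x, y}" using assms xy(1) by blast
  ultimately obtain \<sigma>' where s: "\<sigma>' \<noteq> \<sigma>" "{\<rho> \<in> T. \<tau> facet_of \<rho>} = {\<sigma>, \<sigma>'}"
    by (metis insertE insert_commute singletonD)
  then have "\<sigma>' \<in> {\<rho> \<in> T. \<tau> facet_of \<rho>}" by simp
  then show ?thesis using that[OF s(1) _ _ s(2)] by blast
qed

text \<open>
  The two tiles sharing the facet cover both half-spaces near \<open>p\<close>, so an interior point of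
  \<open>\<rho>\<close>, moved close to \<open>p\<close>, lies in one of them.
\<close>

lemma tile_at_facet_point:
  assumes \<sigma>: "\<sigma> \<in> T" and \<tau>: "\<tau> facet_of \<sigma>" and p: "p \<in> rel_interior \<tau>" and \<rho>: "\<rho> \<in> T" "p \<in> \<rho>"
  shows "\<tau> facet_of \<rho>"
proof -
  obtain \<sigma>' where \<sigma>': "\<sigma>' \<noteq> \<sigma>" "\<sigma>' \<in> T" "\<tau> facet_of \<sigma>'" using facet_two_tiles[OF \<sigma> \<tau>] .
  obtain a where a: "\<sigma> \<subseteq> {x. a \<bullet> x \<le> 0}" "\<tau> = \<sigma> \<inter> {x. a \<bullet> x = 0}"
    "\<sigma>' \<subseteq> {x. (- a) \<bullet> x \<le> 0}" "\<tau> = \<sigma>' \<inter> {x. (- a) \<bullet> x = 0}" "span \<tau> = {x. a \<bullet> x = 0}"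
    using facet_opposite_sides[OF tile(1)[OF \<sigma>] \<tau> tile(1)[OF \<sigma>'(2)] \<sigma>'(3)]
      tiles_disjoint[OF \<sigma> \<sigma>'(2)] \<sigma>'(1) by metis
  have a5: "span \<tau> = {x. (- a) \<bullet> x = 0}" using a(5) by simp
  obtain w where w: "w \<in> interior \<rho>" using full_cone_interior[OF tile(1)[OF \<rho>(1)]] by blast
  have int: "p + t *\<^sub>R w \<in> interior \<rho>" if "t > 0" for t
    using polyhedral_cone_add_interior[OF tile_polyhedral[OF \<rho>(1)] \<rho>(2) w that] .
  consider "a \<bullet> w \<le> 0" | "(- a) \<bullet> w \<le> 0" by fastforce
  then show ?thesis
  proof cases
    case 1
    obtain e where "e > 0" "p + e *\<^sub>R w \<in> \<sigma>"
      using facet_add_direction[OF tile(1)[OF \<sigma>] \<tau> a(1,2,5) p 1] by (metis order_refl)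
    then have "\<rho> = \<sigma>" using tile_eqI[OF \<rho>(1) \<sigma> int] by blast
    then show ?thesis using \<tau> by simp
  next
    case 2
    obtain e where "e > 0" "p + e *\<^sub>R w \<in> \<sigma>'"
      using facet_add_direction[OF tile(1)[OF \<sigma>'(2)] \<sigma>'(3) a(3,4) a5 p 2] by (metis order_refl)
    then have "\<rho> = \<sigma>'" using tile_eqI[OF \<rho>(1) \<sigma>'(2) int] by blast
    then show ?thesis using \<sigma>'(3) by simp
  qed
qed

text \<open>
  The points \<open>y\<close> for which the line through \<open>x\<close> and \<open>y\<close> meets a given codimension-2 face outside
  \<open>x\<close> lie in a proper subspace.
\<close>

lemma negligible_span_insert_ridge:
  assumes \<sigma>: "\<sigma> \<in> T" and \<tau>: "\<tau> facet_of \<sigma>" and \<rho>: "\<rho> facet_of \<tau>"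
  shows "negligible (span (insert x \<rho>))"
proof -
  have "polyhedral_cone \<tau>"
    using polyhedral_cone_face[OF tile_polyhedral[OF \<sigma>]] \<tau> by (simp add: facet_of_def)
  then have "polyhedral_cone \<rho>" using polyhedral_cone_face \<rho> by (auto simp: facet_of_def)
  then have "0 \<in> \<rho>" by (rule polyhedral_coneD)
  then have "int (dim \<rho>) = int DIM('a) - 2"
    using \<tau> \<rho> tile(1)[OF \<sigma>] by (simp add: facet_of_def full_cone_def aff_dim_zero hull_inc)
  then have "dim (span (insert x \<rho>)) < DIM('a)" by (auto simp: dim_insert)
  then show ?thesis by (rule negligible_lowdim)
qed

text \<open>
  There are countably many tiles, so almost every \<open>y\<close> in the interior of \<open>\<sigma>'\<close> avoids the spans
  of \<open>x\<close> and the faces of codimension 2, and then the segment from \<open>x\<close> to \<open>y\<close> meets no such face,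
  except possibly in \<open>x\<close>. A point on it where tiles with different values meet is a boundary point
  of its tiles, hence in the relative interior of a facet, and this facet is shared by both tiles.
\<close>

lemma constant_if_adjacent_equal:
  assumes adj: "\<And>\<tau> \<sigma> \<sigma>'. \<sigma> \<in> T \<Longrightarrow> \<sigma>' \<in> T \<Longrightarrow> \<tau> facet_of \<sigma> \<Longrightarrow> \<tau> facet_of \<sigma>' \<Longrightarrow> f \<sigma> = f \<sigma>'"
    and \<sigma>: "\<sigma> \<in> T" and \<sigma>': "\<sigma>' \<in> T"
  shows "f \<sigma> = f \<sigma>'"
proof (rule ccontr)
  assume ne: "f \<sigma> \<noteq> f \<sigma>'"
  obtain x where x: "x \<in> interior \<sigma>" using full_cone_interior[OF tile(1)[OF \<sigma>]] by blast
  define R where "R = (\<Union>\<sigma>\<in>T. \<Union>\<tau>\<in>facets \<sigma>. facets \<tau>)"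
  have fin: "finite (facets \<tau>)" if "polyhedral_cone \<tau>" for \<tau> :: "'a set"
    using finite_polyhedron_facets[OF polyhedral_coneD(5)[OF that]] by (simp add: facets_def)
  have poly\<tau>: "polyhedral_cone \<tau>" if "\<tau> facet_of \<rho>" "\<rho> \<in> T" for \<tau> \<rho>
    using polyhedral_cone_face[OF tile_polyhedral[OF that(2)]] that(1) by (simp add: facet_of_def)
  have "countable R"
    unfolding R_def using fin tile_polyhedral poly\<tau>
    by (intro countable_UN countable_tiles countable_finite) (auto simp: facets_def)
  then have "negligible (\<Union>\<rho>\<in>R. span (insert x \<rho>))"
    by (intro negligible_countable_Union)
      (auto simp: R_def facets_def intro: negligible_span_insert_ridge)
  moreover have "\<not> negligible (interior \<sigma>')"
    using full_cone_interior(1)[OF tile(1)[OF \<sigma>']] open_not_negligible by blast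
  ultimately have "\<not> interior \<sigma>' \<subseteq> (\<Union>\<rho>\<in>R. span (insert x \<rho>))"
    using negligible_subset by blast
  then obtain y where y: "y \<in> interior \<sigma>'" and generic: "\<And>\<rho>. \<rho> \<in> R \<Longrightarrow> y \<notin> span (insert x \<rho>)"
    by blast
  define L where "L = closed_segment x y"
  define A B where "A = {\<rho> \<in> T. f \<rho> = f \<sigma>}" and "B = {\<rho> \<in> T. f \<rho> \<noteq> f \<sigma>}"
  have LC: "L \<subseteq> C"
    unfolding L_def using x y interior_tile_subset \<sigma> \<sigma>' convex_C by (meson closed_segment_subset subsetD)
  have "\<Union>T \<subseteq> \<Union>A \<union> \<Union>B" by (auto simp: A_def B_def)
  then have "L \<subseteq> \<Union>A \<union> \<Union>B" using LC cover by blast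
  then have cov: "L \<subseteq> closure (\<Union>A) \<union> closure (\<Union>B)" using closure_subset by blast
  have "x \<in> \<Union>A" "y \<in> \<Union>B"
    using x y ne \<sigma> \<sigma>' interior_subset by (fastforce simp: A_def B_def)+
  then have "x \<in> closure (\<Union>A) \<inter> L" "y \<in> closure (\<Union>B) \<inter> L"
    using closure_subset[of "\<Union>A"] closure_subset[of "\<Union>B"] ends_in_segment unfolding L_def by blast+
  moreover have "connected L" by (simp add: L_def)
  ultimately have "closure (\<Union>A) \<inter> closure (\<Union>B) \<inter> L \<noteq> {}"
    using connected_closedD[of L "closure (\<Union>A)" "closure (\<Union>B)"] cov by blast
  then obtain p where p: "p \<in> L" "p \<in> closure (\<Union>A)" "p \<in> closure (\<Union>B)" by blast
  have "A \<subseteq> T" "B \<subseteq> T" by (auto simp: A_def B_def)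
  then have "p \<in> \<Union>A" "p \<in> \<Union>B" using p LC in_closure_Union_tiles by blast+
  then obtain \<rho>\<^sub>1 \<rho>\<^sub>2 where \<rho>\<^sub>1: "\<rho>\<^sub>1 \<in> T" "f \<rho>\<^sub>1 = f \<sigma>" "p \<in> \<rho>\<^sub>1" and \<rho>\<^sub>2: "\<rho>\<^sub>2 \<in> T" "f \<rho>\<^sub>2 \<noteq> f \<sigma>" "p \<in> \<rho>\<^sub>2"
    by (auto simp: A_def B_def)
  \<comment> \<open>The point \<open>x\<close> lies in no tile but \<open>\<sigma>\<close>, which excludes the only point at which the segment could
    meet a face of codimension 2.\<close>
  have px: "p \<noteq> x" using tile_eqI[OF \<sigma> \<rho>\<^sub>2(1) x] \<rho>\<^sub>2 by blast
  have "p \<notin> interior \<rho>\<^sub>1" using tile_eqI[OF \<rho>\<^sub>1(1) \<rho>\<^sub>2(1)] \<rho>\<^sub>1 \<rho>\<^sub>2 by metis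
  then have "p \<in> rel_frontier \<rho>\<^sub>1"
    using \<rho>\<^sub>1(3) tile(1)[OF \<rho>\<^sub>1(1)] closure_subset[of \<rho>\<^sub>1]
    by (auto simp: rel_frontier_def full_cone_def interior_rel_interior_gen)
  then obtain \<tau> where \<tau>: "\<tau> facet_of \<rho>\<^sub>1" "p \<in> \<tau>"
    using rel_frontier_of_polyhedron[OF polyhedral_coneD(5)[OF tile_polyhedral[OF \<rho>\<^sub>1(1)]]] by auto
  have "p \<in> rel_interior \<tau>"
  proof (rule ccontr)
    assume "p \<notin> rel_interior \<tau>"
    then have "p \<in> rel_frontier \<tau>" using \<tau>(2) closure_subset[of \<tau>] by (auto simp: rel_frontier_def)
    then obtain \<rho> where \<rho>: "\<rho> facet_of \<tau>" "p \<in> \<rho>"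
      using rel_frontier_of_polyhedron[OF polyhedral_coneD(5)[OF poly\<tau>[OF \<tau>(1) \<rho>\<^sub>1(1)]]] by auto
    have "\<rho> \<in> R" using \<rho> \<tau> \<rho>\<^sub>1(1) by (auto simp: R_def facets_def)
    obtain u where u: "p = (1 - u) *\<^sub>R x + u *\<^sub>R y" using p(1) by (auto simp: L_def in_segment)
    then have "u \<noteq> 0" using px by auto
    then have "y = inverse u *\<^sub>R (p - (1 - u) *\<^sub>R x)" using u by simp
    also have "\<dots> \<in> span (insert x \<rho>)"
      using \<rho>(2) by (intro real_vector.span_scale real_vector.span_diff real_vector.span_base) auto
    finally show False using generic[OF \<open>\<rho> \<in> R\<close>] by simp
  qed
  then have "\<tau> facet_of \<rho>\<^sub>2" using tile_at_facet_point[OF \<rho>\<^sub>1(1) \<tau>(1) _ \<rho>\<^sub>2(1,3)] by blast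
  then have "f \<rho>\<^sub>1 = f \<rho>\<^sub>2" using adj \<rho>\<^sub>1(1) \<rho>\<^sub>2(1) \<tau>(1) by blast
  then show False using \<rho>\<^sub>1(2) \<rho>\<^sub>2(2) by simp
qed

end

section \<open>Orientation signs\<close>

lemma orientation_exists:
  assumes "X \<in> orientations V"
  shows "\<exists>bs. bs \<in> X"
  using assms coord_det_self unfolding orientations_def orientation_class_def by fastforce

lemma orientation_basis:
  assumes "X \<in> orientations V" "bs \<in> X"
  shows "ordered_basis V bs"
  using assms by (auto simp: orientations_def orientation_class_def)

lemma ordered_basis_subset:
  assumes "ordered_basis V bs"
  shows "set bs \<subseteq> V"
  using assms real_vector.span_superset by (auto simp: ordered_basis_def)

lemma coord_det_trans:
  fixes V :: "'a::euclidean_space set"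
  assumes "ordered_basis V as" "ordered_basis V bs" "ordered_basis V cs"
  shows "coord_det as cs = coord_det as bs * coord_det bs cs"
  using assms by (intro coord_det_mult) (auto simp: ordered_basis_length dest: ordered_basis_subset)

text \<open>
  Any member of an orientation serves as its reference basis.
\<close>

lemma orientation_iff:
  fixes V :: "'a::euclidean_space set"
  assumes X: "X \<in> orientations V" and bs: "bs \<in> X" and cs: "ordered_basis V cs"
  shows "cs \<in> X \<longleftrightarrow> coord_det bs cs > 0"
proof -
  obtain b0 where b0: "ordered_basis V b0" "X = orientation_class V b0"
    using X by (auto simp: orientations_def)
  then have "coord_det b0 bs > 0" "ordered_basis V bs"
    using bs by (auto simp: orientation_class_def)
  then show ?thesis
    using coord_det_trans[OF b0(1) _ cs, of bs] cs b0(2)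
    by (simp add: orientation_class_def zero_less_mult_iff)
qed

lemma ordered_basis_snoc_hyperplane:
  fixes a :: "'a::euclidean_space"
  assumes bs: "ordered_basis {x. a \<bullet> x = 0} bs" and v: "a \<bullet> v \<noteq> 0"
  shows "ordered_basis UNIV (bs @ [v])"
proof -
  have V: "span (set bs) = {x. a \<bullet> x = 0}" and d: "distinct bs" "independent (set bs)"
    using bs by (auto simp: ordered_basis_def)
  have nv: "v \<notin> span (set bs)" using v V by simp
  then have "v \<notin> set bs" by (auto intro: real_vector.span_base)
  moreover have "independent (insert v (set bs))"
    using d nv by (intro real_vector.independent_insertI) auto
  moreover have "span (insert v (set bs)) = UNIV"
  proof -
    have "a \<noteq> 0" using v by auto
    then have "dim (span (set bs)) = DIM('a) - 1" unfolding V by (rule dim_hyperplane)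
    then have "dim (insert v (set bs)) = DIM('a)" using nv by (simp add: dim_insert)
    then show ?thesis by (simp add: dim_eq_full)
  qed
  ultimately show ?thesis using d by (simp add: ordered_basis_def)
qed

text \<open>
  As a function of \<open>w\<close>, the orientation of \<open>(cs, w)\<close> depends only on the side of the hyperplane that
  contains \<open>w\<close>.
\<close>

lemma coord_det_snoc_hyperplane:
  fixes a :: "'a::euclidean_space"
  assumes es: "ordered_basis UNIV es"
    and bs: "ordered_basis {x. a \<bullet> x = 0} bs" and cs: "ordered_basis {x. a \<bullet> x = 0} cs"
    and v: "a \<bullet> v \<noteq> 0"
  shows "coord_det es (cs @ [w]) = coord_det es (bs @ [v]) * coord_det bs cs * ((a \<bullet> w) / (a \<bullet> v))"
proof -
  define c where "c = (a \<bullet> w) / (a \<bullet> v)"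
  define h where "h = w - c *\<^sub>R v"
  have h: "h \<in> {x. a \<bullet> x = 0}" using v by (simp add: h_def c_def inner_diff_right)
  have len: "length cs = length bs" using bs cs by (simp add: ordered_basis_length)
  have "coord_det (bs @ [v]) (cs @ [c *\<^sub>R v + h]) = coord_det bs cs * c"
    using coord_det_snoc[OF bs _ len ordered_basis_subset[OF cs] h] v by simp
  moreover have "coord_det es (cs @ [w]) = coord_det es (bs @ [v]) * coord_det (bs @ [v]) (cs @ [w])"
    using len by (intro coord_det_mult[OF es ordered_basis_snoc_hyperplane[OF bs v]]) auto
  ultimately show ?thesis by (simp add: h_def c_def)
qed

lemma coord_det_nonzero:
  fixes V :: "'a::euclidean_space set"
  assumes "ordered_basis V as" "ordered_basis V bs"
  shows "coord_det as bs \<noteq> 0"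
  using coord_det_inverse[OF assms] by auto

lemma facet_of_linear_image:
  assumes "linear f" "inj f" "\<tau> facet_of \<sigma>"
  shows "f ` \<tau> facet_of f ` \<sigma>"
  using assms by (auto simp: facet_of_def face_of_linear_image aff_dim_injective_linear_image)

locale tessellation_action = cone_tessellation C T
  for C :: "'n::{finite,linorder} rvec set" and T :: "'n rvec set set" +
  fixes G :: "('g, 'k) monoid_scheme" and \<phi> :: "'g \<Rightarrow> 'n rvec \<Rightarrow> 'n rvec"
    and ori :: "'n rvec set \<Rightarrow> 'n rvec list set"
  assumes pointed: "\<And>\<sigma> x. \<sigma> \<in> T \<Longrightarrow> x \<in> \<sigma> \<Longrightarrow> - x \<in> \<sigma> \<Longrightarrow> x = 0"
    and action: "group_action G UNIV \<phi>"
    and linear_action: "\<And>g. g \<in> carrier G \<Longrightarrow> linear (\<phi> g)"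
    and det_action: "\<And>g. g \<in> carrier G \<Longrightarrow> Determinants.det (matrix (\<phi> g)) > 0"
    and tiles_invariant: "\<And>g \<sigma>. g \<in> carrier G \<Longrightarrow> \<sigma> \<in> T \<Longrightarrow> \<phi> g ` \<sigma> \<in> T"
    and finite_stabilizer: "\<And>\<sigma>. \<sigma> \<in> T \<Longrightarrow> finite (stabilizer G (act_on_sets \<phi>) \<sigma>)"
    and ori: "\<And>\<tau>. \<tau> \<in> codim1_faces T \<Longrightarrow> ori \<tau> \<in> orientations (span \<tau>)"
begin

lemma bij_action: "g \<in> carrier G \<Longrightarrow> bij (\<phi> g)"
  using group_action.surj_prop[OF action] group_action.inj_prop[OF action] by (simp add: bij_def)

lemma inj_action: "g \<in> carrier G \<Longrightarrow> inj (\<phi> g)"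
  using bij_action bij_is_inj by blast

lemma codim1_face: "\<sigma> \<in> T \<Longrightarrow> \<tau> facet_of \<sigma> \<Longrightarrow> \<tau> \<in> codim1_faces T"
  by (auto simp: codim1_faces_def facets_def)

lemma facet_action:
  assumes "g \<in> carrier G" "\<tau> facet_of \<sigma>"
  shows "\<phi> g ` \<tau> facet_of \<phi> g ` \<sigma>"
  using facet_of_linear_image linear_action inj_action assms by blast

lemma ordered_basis_action:
  assumes "g \<in> carrier G" "ordered_basis (span \<tau>) bs"
  shows "ordered_basis (span (\<phi> g ` \<tau>)) (map (\<phi> g) bs)"
  using ordered_basis_map[OF linear_action[OF assms(1)] inj_action[OF assms(1)] assms(2)]
  by (simp add: real_vector.linear_span_image[OF linear_action[OF assms(1)]])

lemma coord_det_action: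
  assumes "g \<in> carrier G" "ordered_basis V bs" "length cs = length bs" "set cs \<subseteq> V"
  shows "coord_det (map (\<phi> g) bs) (map (\<phi> g) cs) = coord_det bs cs"
  using coord_det_map[OF linear_action[OF assms(1)] inj_action[OF assms(1)] assms(2-4)] .

lemma coord_det_std_action:
  assumes g: "g \<in> carrier G" and len: "length cs = CARD('n)"
  shows "coord_det std_basis (map (\<phi> g) cs) = Determinants.det (matrix (\<phi> g)) * coord_det std_basis cs"
proof -
  have l: "length (std_basis :: 'n rvec list) = CARD('n)"
    using ordered_basis_length[OF ordered_basis_std] by simp
  have "ordered_basis (range (\<phi> g)) (map (\<phi> g) std_basis)"
    by (rule ordered_basis_map[OF linear_action[OF g] inj_action[OF g] ordered_basis_std])
  moreover have "range (\<phi> g) = UNIV" using bij_action[OF g] by (simp add: bij_def)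
  ultimately have "ordered_basis UNIV (map (\<phi> g) std_basis)" by simp
  then have "coord_det std_basis (map (\<phi> g) cs) = coord_det std_basis (map (\<phi> g) std_basis) *
      coord_det (map (\<phi> g) std_basis) (map (\<phi> g) cs)"
    using len l by (intro coord_det_mult[OF ordered_basis_std]) auto
  also have "coord_det (map (\<phi> g) std_basis) (map (\<phi> g) cs) = coord_det std_basis cs"
    using len l by (intro coord_det_action[OF g ordered_basis_std]) auto
  finally show ?thesis by (simp add: coord_det_std_map)
qed

text \<open>
  Replacing \<open>(bs, v)\<close> by \<open>(cs, w)\<close> changes the determinant by \<open>coord_det bs cs\<close> and a positive factor, because
  all points of \<open>\<sigma>\<close> outside the facet lie on one side of it.
\<close>

lemma side_value:
  assumes \<sigma>: "\<sigma> \<in> T" "\<tau> facet_of \<sigma>" and bs: "ordered_basis (span \<tau>) bs"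
    and v: "v \<in> \<sigma>" "v \<notin> \<tau>"
  shows "coord_det std_basis (bs @ [v]) \<noteq> 0"
    and "ordered_basis UNIV (bs @ [v])"
    and "\<And>cs w. ordered_basis (span \<tau>) cs \<Longrightarrow> w \<in> \<sigma> \<Longrightarrow> w \<notin> \<tau> \<Longrightarrow>
      \<exists>r>0. coord_det std_basis (cs @ [w]) = coord_det std_basis (bs @ [v]) * coord_det bs cs * r"
proof -
  obtain a where a: "\<sigma> \<subseteq> {x. a \<bullet> x \<le> 0}" "\<tau> = \<sigma> \<inter> {x. a \<bullet> x = 0}" "span \<tau> = {x. a \<bullet> x = 0}"
    using facet_hyperplane[OF tile(1)[OF \<sigma>(1)] \<sigma>(2)] by metis
  have neg: "a \<bullet> w < 0" if "w \<in> \<sigma>" "w \<notin> \<tau>" for w using a(1,2) that by force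
  have v0: "a \<bullet> v \<noteq> 0" using neg[OF v] by simp
  show B: "ordered_basis UNIV (bs @ [v])"
    using ordered_basis_snoc_hyperplane bs v0 unfolding a(3) .
  show "coord_det std_basis (bs @ [v]) \<noteq> 0" by (rule coord_det_nonzero[OF ordered_basis_std B])
  show "\<exists>r>0. coord_det std_basis (cs @ [w]) = coord_det std_basis (bs @ [v]) * coord_det bs cs * r"
    if "ordered_basis (span \<tau>) cs" "w \<in> \<sigma>" "w \<notin> \<tau>" for cs w
    using coord_det_snoc_hyperplane[OF ordered_basis_std bs[unfolded a(3)] that(1)[unfolded a(3)] v0, of w]
      neg[OF v] neg[OF that(2,3)] by (intro exI[of _ "(a \<bullet> w) / (a \<bullet> v)"]) (auto simp: divide_neg_neg)
qed

text \<open>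
  By \<open>side_value\<close>, extreme rays can be replaced by arbitrary points of \<open>\<sigma> - \<tau>\<close>; these, unlike
  generators of extreme rays, are easy to find and to transport.
\<close>

lemma eps_sign_eq:
  assumes \<sigma>: "\<sigma> \<in> T" "\<tau> facet_of \<sigma>" and bs: "bs \<in> ori \<tau>" and v: "v \<in> \<sigma>" "v \<notin> \<tau>"
  shows "eps_sign ori \<sigma> \<tau> = (if coord_det std_basis (bs @ [v]) > 0 then 1 else - 1)"
proof -
  note O = ori[OF codim1_face[OF \<sigma>]]
  have bsb: "ordered_basis (span \<tau>) bs" by (rule orientation_basis[OF O bs])
  have pc: "polyhedral_cone \<sigma>" by (rule tile_polyhedral[OF \<sigma>(1)])
  then have p\<tau>: "polyhedral_cone \<tau>" using polyhedral_cone_face \<sigma>(2) by (auto simp: facet_of_def)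
  have ray: "extreme_ray_generator \<sigma> w \<Longrightarrow> w \<in> \<sigma>" for w
    unfolding extreme_ray_generator_def using face_of_imp_subset by (fastforce intro: exI[of _ 1])
  have sub: "{c *\<^sub>R w |c. c \<ge> 0} \<subseteq> \<tau> \<longleftrightarrow> w \<in> \<tau>" for w
  proof
    assume "{c *\<^sub>R w |c. c \<ge> 0} \<subseteq> \<tau>"
    moreover have "1 *\<^sub>R w \<in> {c *\<^sub>R w |c. c \<ge> 0}" by (auto intro: exI[of _ 1])
    ultimately show "w \<in> \<tau>" by auto
  qed (auto intro: polyhedral_coneD(6)[OF p\<tau>])
  have std: "cs \<in> standard_orientation \<longleftrightarrow> ordered_basis UNIV cs \<and> coord_det std_basis cs > 0"
    for cs :: "'n rvec list"
    by (simp add: standard_orientation_def orientation_class_def std_basis_def)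
  have pos: "coord_det std_basis (cs @ [w]) > 0 \<longleftrightarrow> coord_det std_basis (bs @ [v]) > 0"
    if cs: "cs \<in> ori \<tau>" and w: "w \<in> \<sigma>" "w \<notin> \<tau>" for cs w
  proof -
    have cb: "ordered_basis (span \<tau>) cs" by (rule orientation_basis[OF O cs])
    have "coord_det bs cs > 0" using orientation_iff[OF O bs cb] cs by simp
    moreover obtain r where "r > 0"
      "coord_det std_basis (cs @ [w]) = coord_det std_basis (bs @ [v]) * coord_det bs cs * r"
      using side_value(3)[OF \<sigma> bsb v cb w] by blast
    ultimately show ?thesis by (simp add: zero_less_mult_iff)
  qed
  have "\<not> \<sigma> \<subseteq> \<tau>" using v by blast
  then obtain w where w: "extreme_ray_generator \<sigma> w" "w \<notin> \<tau>"
    using extreme_ray_avoiding[OF pc pointed[OF \<sigma>(1)] p\<tau>] by blast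
  have "(\<exists>bs v. bs \<in> ori \<tau> \<and> extreme_ray_generator \<sigma> v \<and> \<not> {c *\<^sub>R v |c. c \<ge> 0} \<subseteq> \<tau> \<and>
           bs @ [v] \<in> standard_orientation) \<longleftrightarrow> coord_det std_basis (bs @ [v]) > 0"
    (is "?L \<longleftrightarrow> ?R")
  proof
    assume ?L
    then show ?R using pos ray unfolding sub std by blast
  next
    assume ?R
    then have "bs @ [w] \<in> standard_orientation"
      using pos[OF bs ray[OF w(1)] w(2)] side_value(2)[OF \<sigma> bsb ray[OF w(1)] w(2)] unfolding std by blast
    then show ?L using bs w unfolding sub by blast
  qed
  then show ?thesis unfolding eps_sign_def by simp
qed

lemma eps_sign_opposite:
  assumes \<sigma>: "\<sigma> \<in> T" "\<tau> facet_of \<sigma>" and \<sigma>': "\<sigma>' \<in> T" "\<tau> facet_of \<sigma>'" and ne: "\<sigma> \<noteq> \<sigma>'"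
  shows "eps_sign ori \<sigma>' \<tau> = - eps_sign ori \<sigma> \<tau>"
proof -
  obtain a where a: "\<sigma> \<subseteq> {x. a \<bullet> x \<le> 0}" "\<tau> = \<sigma> \<inter> {x. a \<bullet> x = 0}"
    "\<sigma>' \<subseteq> {x. (- a) \<bullet> x \<le> 0}" "\<tau> = \<sigma>' \<inter> {x. (- a) \<bullet> x = 0}" "span \<tau> = {x. a \<bullet> x = 0}"
    using facet_opposite_sides[OF tile(1)[OF \<sigma>(1)] \<sigma>(2) tile(1)[OF \<sigma>'(1)] \<sigma>'(2)
        tiles_disjoint[OF \<sigma>(1) \<sigma>'(1) ne]] by metis
  note O = ori[OF codim1_face[OF \<sigma>]]
  obtain bs where bs: "bs \<in> ori \<tau>" using orientation_exists[OF O] by blast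
  have bsb: "ordered_basis (span \<tau>) bs" by (rule orientation_basis[OF O bs])
  obtain v where v: "v \<in> \<sigma>" "v \<notin> \<tau>" using facet_proper[OF \<sigma>(2)] by blast
  obtain w where w: "w \<in> \<sigma>'" "w \<notin> \<tau>" using facet_proper[OF \<sigma>'(2)] by blast
  have av: "a \<bullet> v < 0" using a(1,2) v by force
  have "- a \<bullet> w \<noteq> 0" using a(4) w by blast
  moreover have "- a \<bullet> w \<le> 0" using a(3) w by blast
  ultimately have aw: "a \<bullet> w > 0" by simp
  define r where "r = (a \<bullet> w) / (a \<bullet> v)"
  have "coord_det std_basis (bs @ [w]) = coord_det std_basis (bs @ [v]) * r"
    unfolding r_def using coord_det_snoc_hyperplane[OF ordered_basis_std bsb[unfolded a(5)] bsb[unfolded a(5)], of v w] av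
      coord_det_self[OF bsb] by simp
  moreover have "r < 0" using av aw by (simp add: r_def divide_pos_neg)
  ultimately have "coord_det std_basis (bs @ [w]) > 0 \<longleftrightarrow> coord_det std_basis (bs @ [v]) < 0"
    by (simp add: zero_less_mult_iff)
  then show ?thesis
    using eps_sign_eq[OF \<sigma> bs v] eps_sign_eq[OF \<sigma>' bs w] side_value(1)[OF \<sigma> bsb v] by auto
qed

lemma det_on_stabilizer:
  assumes "g \<in> carrier G" "\<phi> g ` \<tau> = \<tau>" "ordered_basis (span \<tau>) bs"
  shows "det_on (span \<tau>) (\<phi> g) = coord_det bs (map (\<phi> g) bs)"
  using assms linear_action inj_action
  by (intro det_on_eq) (auto simp flip: real_vector.linear_span_image)

text \<open>
  Tiles span the whole space, where the group acts with positive determinant. So the representatives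
  of tiles represent all orbits of tiles.
\<close>

lemma tile_not_reversed:
  assumes "\<sigma> \<in> T"
  shows "\<not> stabilizer_reverses G \<phi> \<sigma>"
proof -
  have "span \<sigma> = UNIV"
  proof -
    have "dim \<sigma> = DIM('n rvec)"
      using tile(1)[OF assms] polyhedral_coneD(3)[OF tile_polyhedral[OF assms]]
      by (simp add: full_cone_def aff_dim_zero hull_inc)
    then show ?thesis by (simp only: dim_eq_full)
  qed
  then have "ordered_basis (span \<sigma>) std_basis" using ordered_basis_std by simp
  then have "det_on (span \<sigma>) (\<phi> g) > 0" if "g \<in> carrier G" "\<phi> g ` \<sigma> = \<sigma>" for g
    using det_on_stabilizer[OF that] det_action[OF that(1)] by (simp add: coord_det_std_map)
  then show ?thesis
    by (fastforce simp: stabilizer_reverses_def stabilizer_def act_on_sets_def)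
qed

text \<open>
  If \<open>g\<close> reverses \<open>\<tau>\<close> but preserves the ambient orientation, it has to exchange the two sides of \<open>\<tau>\<close>.
\<close>

lemma reversing_moves_tile:
  assumes \<sigma>: "\<sigma> \<in> T" "\<tau> facet_of \<sigma>" and g: "g \<in> carrier G" "\<phi> g ` \<tau> = \<tau>"
    and rev: "det_on (span \<tau>) (\<phi> g) < 0"
  shows "\<phi> g ` \<sigma> \<noteq> \<sigma>"
proof
  assume s: "\<phi> g ` \<sigma> = \<sigma>"
  note O = ori[OF codim1_face[OF \<sigma>]]
  obtain bs where bs: "bs \<in> ori \<tau>" using orientation_exists[OF O] by blast
  have bsb: "ordered_basis (span \<tau>) bs" by (rule orientation_basis[OF O bs])
  have neg: "coord_det bs (map (\<phi> g) bs) < 0" using det_on_stabilizer[OF g bsb] rev by simp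
  obtain v where v: "v \<in> \<sigma>" "v \<notin> \<tau>" using facet_proper[OF \<sigma>(2)] by blast
  have gv: "\<phi> g v \<in> \<sigma>" "\<phi> g v \<notin> \<tau>"
    using v s g(2) inj_action[OF g(1)] by (blast, metis inj_image_mem_iff)
  have "ordered_basis (span \<tau>) (map (\<phi> g) bs)" using ordered_basis_action[OF g(1) bsb] g(2) by simp
  then obtain r where r: "r > 0" "coord_det std_basis (map (\<phi> g) bs @ [\<phi> g v]) =
      coord_det std_basis (bs @ [v]) * coord_det bs (map (\<phi> g) bs) * r"
    using side_value(3)[OF \<sigma> bsb v _ gv] by blast
  have "length (bs @ [v]) = CARD('n)"
    using ordered_basis_length[OF side_value(2)[OF \<sigma> bsb v]] by simp
  then have "coord_det std_basis (map (\<phi> g) bs @ [\<phi> g v]) =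
      Determinants.det (matrix (\<phi> g)) * coord_det std_basis (bs @ [v])"
    using coord_det_std_action[OF g(1), of "bs @ [v]"] by simp
  with r(2) have "Determinants.det (matrix (\<phi> g)) = coord_det bs (map (\<phi> g) bs) * r"
    using side_value(1)[OF \<sigma> bsb v] by simp
  moreover have "coord_det bs (map (\<phi> g) bs) * r < 0" using neg r(1) by (rule mult_neg_pos)
  ultimately show False using det_action[OF g(1)] by simp
qed

lemma act_compose:
  assumes "g \<in> carrier G" "h \<in> carrier G"
  shows "\<phi> (g \<otimes>\<^bsub>G\<^esub> h) = \<phi> g \<circ> \<phi> h"
  using group_action.composition_rule[OF action _ assms] by auto

lemma group_G: "group G"
  using action by (simp add: group_action_def group_hom_def)

lemma act_inv:
  assumes "g \<in> carrier G"
  shows "\<phi> (inv\<^bsub>G\<^esub> g) (\<phi> g x) = x" "\<phi> g (\<phi> (inv\<^bsub>G\<^esub> g) x) = x"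
proof -
  interpret group G by (rule group_G)
  have inv: "inv\<^bsub>G\<^esub> g \<in> carrier G" using assms by simp
  show "\<phi> (inv\<^bsub>G\<^esub> g) (\<phi> g x) = x" 
    using group_action.orbit_sym_aux[OF action assms] by simp
  show "\<phi> g (\<phi> (inv\<^bsub>G\<^esub> g) x) = x" 
    using group_action.orbit_sym_aux[OF action inv, of x] assms by simp
qed

text \<open>
  Two group elements that carry \<open>\<tau>\<close> to the same facet differ by an element of the stabilizer of \<open>\<tau>\<close>,
  which does not reverse the orientation, so both give the same sign.
\<close>

lemma eta_sign_eq:
  assumes \<tau>: "\<tau> \<in> codim1_faces T" "\<not> stabilizer_reverses G \<phi> \<tau>" and g: "g \<in> carrier G"
    and g\<tau>: "\<phi> g ` \<tau> \<in> codim1_faces T" and bs: "bs \<in> ori \<tau>" and bs': "bs' \<in> ori (\<phi> g ` \<tau>)"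
  shows "eta_sign G \<phi> ori \<tau> (\<phi> g ` \<tau>) = (if coord_det bs' (map (\<phi> g) bs) > 0 then 1 else - 1)"
proof -
  interpret group G by (rule group_G)
  note O = ori[OF \<tau>(1)] and O' = ori[OF g\<tau>]
  have bsb: "ordered_basis (span \<tau>) bs" by (rule orientation_basis[OF O bs])
  have bsb': "ordered_basis (span (\<phi> g ` \<tau>)) bs'" by (rule orientation_basis[OF O' bs'])
  note gbs = ordered_basis_action[OF g bsb]
  have "coord_det bs' (map (\<phi> g) bs) > 0"
    if h: "h \<in> carrier G" "\<phi> g ` \<tau> = \<phi> h ` \<tau>" and cs: "cs \<in> ori \<tau>" "map (\<phi> h) cs \<in> ori (\<phi> g ` \<tau>)"
    for h cs
  proof -
    define k where "k = inv\<^bsub>G\<^esub> g \<otimes>\<^bsub>G\<^esub> h"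
    have k: "k \<in> carrier G" using g h by (simp add: k_def)
    have ks: "\<phi> k x = \<phi> (inv\<^bsub>G\<^esub> g) (\<phi> h x)" for x using act_compose g h(1) by (simp add: k_def)
    have kh: "\<phi> g (\<phi> k x) = \<phi> h x" for x using act_inv[OF g] by (simp add: ks)
    have "\<phi> k ` \<tau> = \<phi> (inv\<^bsub>G\<^esub> g) ` \<phi> g ` \<tau>" unfolding h(2) by (auto simp: ks image_image)
    also have "\<dots> = \<tau>" by (auto simp: image_image act_inv[OF g])
    finally have k\<tau>: "\<phi> k ` \<tau> = \<tau>" .
    have "\<not> det_on (span \<tau>) (\<phi> k) < 0"
      using \<tau>(2) k k\<tau> by (auto simp: stabilizer_reverses_def stabilizer_def act_on_sets_def)
    then have "\<not> coord_det bs (map (\<phi> k) bs) < 0" using det_on_stabilizer[OF k k\<tau> bsb] by simp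
    moreover have kb: "ordered_basis (span \<tau>) (map (\<phi> k) bs)"
      using ordered_basis_action[OF k bsb] k\<tau> by simp
    ultimately have k1: "coord_det bs (map (\<phi> k) bs) > 0"
      using coord_det_nonzero[OF bsb kb] by simp
    have csb: "ordered_basis (span \<tau>) cs" by (rule orientation_basis[OF O cs(1)])
    have kc: "ordered_basis (span \<tau>) (map (\<phi> k) cs)"
      using ordered_basis_action[OF k csb] k\<tau> by simp
    have "coord_det bs cs > 0" using orientation_iff[OF O bs csb] cs(1) by simp
    moreover have "coord_det (map (\<phi> k) bs) (map (\<phi> k) cs) = coord_det bs cs"
      using csb bsb by (intro coord_det_action[OF k bsb]) (auto simp: ordered_basis_length dest: ordered_basis_subset)
    ultimately have k2: "coord_det bs (map (\<phi> k) cs) > 0"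
      using coord_det_trans[OF bsb kb kc] k1 by simp
    have "map (\<phi> h) cs = map (\<phi> g) (map (\<phi> k) cs)" by (simp add: kh)
    moreover have "coord_det (map (\<phi> g) bs) (map (\<phi> g) (map (\<phi> k) cs)) = coord_det bs (map (\<phi> k) cs)"
      using ordered_basis_length[OF kc] ordered_basis_length[OF bsb] ordered_basis_subset[OF kc]
      by (intro coord_det_action[OF g bsb]) auto
    ultimately have e: "coord_det (map (\<phi> g) bs) (map (\<phi> h) cs) > 0" using k2 by (simp only:)
    have hc: "ordered_basis (span (\<phi> g ` \<tau>)) (map (\<phi> h) cs)" by (rule orientation_basis[OF O' cs(2)])
    have "coord_det bs' (map (\<phi> h) cs) > 0" using orientation_iff[OF O' bs' hc] cs(2) by simp
    then show ?thesis using coord_det_trans[OF bsb' gbs hc] e by (simp add: zero_less_mult_iff)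
  qed
  moreover have "map (\<phi> g) bs \<in> ori (\<phi> g ` \<tau>)" if "coord_det bs' (map (\<phi> g) bs) > 0"
    using orientation_iff[OF O' bs' gbs] that by simp
  ultimately have "(\<exists>h \<in> carrier G. \<phi> g ` \<tau> = act_on_sets \<phi> h \<tau> \<and> (\<exists>cs \<in> ori \<tau>. map (\<phi> h) cs \<in> ori (\<phi> g ` \<tau>)))
      \<longleftrightarrow> coord_det bs' (map (\<phi> g) bs) > 0"
    using g bs unfolding act_on_sets_def by blast
  then show ?thesis by (simp add: eta_sign_def)
qed

text \<open>
  Apply \<open>g\<close> to an adapted basis \<open>(bs, v)\<close> of \<open>(\<tau>, \<sigma>)\<close>: its ambient orientation is preserved, while
  \<open>g bs\<close> differs from a positive basis of \<open>g \<tau>\<close> by the sign \<open>\<eta>\<close>.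
\<close>

lemma eta_eps_equivariant:
  assumes \<sigma>: "\<sigma> \<in> T" "\<tau> facet_of \<sigma>" and nr: "\<not> stabilizer_reverses G \<phi> \<tau>" and g: "g \<in> carrier G"
  shows "eta_sign G \<phi> ori \<tau> (\<phi> g ` \<tau>) * eps_sign ori (\<phi> g ` \<sigma>) (\<phi> g ` \<tau>) = eps_sign ori \<sigma> \<tau>"
proof -
  have \<sigma>': "\<phi> g ` \<sigma> \<in> T" "\<phi> g ` \<tau> facet_of \<phi> g ` \<sigma>"
    using tiles_invariant[OF g \<sigma>(1)] facet_action[OF g \<sigma>(2)] by auto
  note O = ori[OF codim1_face[OF \<sigma>]] and O' = ori[OF codim1_face[OF \<sigma>']]
  obtain bs where bs: "bs \<in> ori \<tau>" using orientation_exists[OF O] by blast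
  obtain bs' where bs': "bs' \<in> ori (\<phi> g ` \<tau>)" using orientation_exists[OF O'] by blast
  have bsb: "ordered_basis (span \<tau>) bs" by (rule orientation_basis[OF O bs])
  have bsb': "ordered_basis (span (\<phi> g ` \<tau>)) bs'" by (rule orientation_basis[OF O' bs'])
  note gbs = ordered_basis_action[OF g bsb]
  obtain v where v: "v \<in> \<sigma>" "v \<notin> \<tau>" using facet_proper[OF \<sigma>(2)] by blast
  have gv: "\<phi> g v \<in> \<phi> g ` \<sigma>" "\<phi> g v \<notin> \<phi> g ` \<tau>"
    using v inj_action[OF g] by (auto simp: inj_image_mem_iff)
  obtain r where r: "r > 0" "coord_det std_basis (map (\<phi> g) bs @ [\<phi> g v]) =
      coord_det std_basis (bs' @ [\<phi> g v]) * coord_det bs' (map (\<phi> g) bs) * r"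
    using side_value(3)[OF \<sigma>' bsb' gv gbs gv] by blast
  have "length (bs @ [v]) = CARD('n)"
    using ordered_basis_length[OF side_value(2)[OF \<sigma> bsb v]] by simp
  then have "Determinants.det (matrix (\<phi> g)) * coord_det std_basis (bs @ [v]) =
      coord_det std_basis (bs' @ [\<phi> g v]) * coord_det bs' (map (\<phi> g) bs) * r"
    using coord_det_std_action[OF g(1), of "bs @ [v]"] r(2) by simp
  then have "coord_det std_basis (bs @ [v]) > 0 \<longleftrightarrow>
      coord_det std_basis (bs' @ [\<phi> g v]) * coord_det bs' (map (\<phi> g) bs) > 0"
    using det_action[OF g] r(1) by (metis zero_less_mult_pos zero_less_mult_pos2 mult_pos_pos)
  then show ?thesis
    using eps_sign_eq[OF \<sigma> bs v] eps_sign_eq[OF \<sigma>' bs' gv] side_value(1)[OF \<sigma>' bsb' gv]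
      eta_sign_eq[OF codim1_face[OF \<sigma>] nr g codim1_face[OF \<sigma>'] bs bs'] coord_det_nonzero[OF bsb' gbs]
    by (auto simp: zero_less_mult_iff)
qed

end

section \<open>Counting incidences\<close>

context tessellation_action
begin

lemma image_act_compose:
  assumes "g \<in> carrier G" "h \<in> carrier G"
  shows "\<phi> (g \<otimes>\<^bsub>G\<^esub> h) ` X = \<phi> g ` \<phi> h ` X"
  using act_compose[OF assms] by (simp add: image_comp)

lemma image_act_inv:
  assumes "g \<in> carrier G"
  shows "\<phi> (inv\<^bsub>G\<^esub> g) ` \<phi> g ` X = X" "\<phi> g ` \<phi> (inv\<^bsub>G\<^esub> g) ` X = X"
  using act_inv[OF assms] by (simp_all add: image_image)

abbreviation stab :: "'n rvec set \<Rightarrow> 'g set" where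
  "stab X \<equiv> stabilizer G (act_on_sets \<phi>) X"

abbreviation orb :: "'n rvec set \<Rightarrow> 'n rvec set set" where
  "orb X \<equiv> orbit G (act_on_sets \<phi>) X"

lemma stab_eq: "stab X = {g \<in> carrier G. \<phi> g ` X = X}"
  by (simp add: stabilizer_def act_on_sets_def)

lemma orb_eq: "orb X = {\<phi> g ` X |g. g \<in> carrier G}"
  by (simp add: orbit_def act_on_sets_def)

lemma orb_refl: "X \<in> orb X"
proof -
  interpret group G by (rule group_G)
  have "\<phi> \<one>\<^bsub>G\<^esub> ` X = X"
    using image_act_compose[of "\<one>\<^bsub>G\<^esub>" "\<one>\<^bsub>G\<^esub>" X] image_act_inv(1)[of "\<one>\<^bsub>G\<^esub>" X] by simp
  then show ?thesis unfolding orb_eq by (metis (mono_tags, lifting) mem_Collect_eq one_closed)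
qed

lemma orb_sym:
  assumes "Y \<in> orb X"
  shows "X \<in> orb Y"
proof -
  interpret group G by (rule group_G)
  obtain g where g: "g \<in> carrier G" "Y = \<phi> g ` X" using assms by (auto simp: orb_eq)
  then have "X = \<phi> (inv\<^bsub>G\<^esub> g) ` Y" by (simp add: image_act_inv)
  then show ?thesis using g(1) unfolding orb_eq by blast
qed

lemma orb_trans:
  assumes "Y \<in> orb X" "Z \<in> orb Y"
  shows "Z \<in> orb X"
proof -
  interpret group G by (rule group_G)
  obtain g h where g: "g \<in> carrier G" "Y = \<phi> g ` X" and h: "h \<in> carrier G" "Z = \<phi> h ` Y"
    using assms by (auto simp: orb_eq)
  then have "Z = \<phi> (h \<otimes>\<^bsub>G\<^esub> g) ` X" by (simp add: image_act_compose)
  then show ?thesis using g h unfolding orb_eq by blast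
qed

text \<open>
  The elements carrying \<open>X\<close> to \<open>Y\<close> form a coset of each of the two stabilizers.
\<close>

lemma transporter_left:
  assumes "g \<in> carrier G" "\<phi> g ` X = Y"
  shows "bij_betw (\<lambda>k. g \<otimes>\<^bsub>G\<^esub> k) (stab X) {h \<in> carrier G. \<phi> h ` X = Y}"
proof -
  interpret group G by (rule group_G)
  have X: "\<phi> (inv\<^bsub>G\<^esub> g) ` Y = X" using assms image_act_inv by blast
  show ?thesis
  proof (rule bij_betw_byWitness[where f' = "\<lambda>h. inv\<^bsub>G\<^esub> g \<otimes>\<^bsub>G\<^esub> h"])
    show "(\<lambda>k. g \<otimes>\<^bsub>G\<^esub> k) ` stab X \<subseteq> {h \<in> carrier G. \<phi> h ` X = Y}"
      by (rule image_subsetI) (use assms in \<open>simp add: stab_eq image_act_compose\<close>)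
    show "(\<lambda>h. inv\<^bsub>G\<^esub> g \<otimes>\<^bsub>G\<^esub> h) ` {h \<in> carrier G. \<phi> h ` X = Y} \<subseteq> stab X"
      by (rule image_subsetI) (use assms X in \<open>simp add: stab_eq image_act_compose\<close>)
  qed (use assms in \<open>simp_all add: stab_eq m_assoc[symmetric]\<close>)
qed

lemma transporter_right:
  assumes "g \<in> carrier G" "\<phi> g ` X = Y"
  shows "bij_betw (\<lambda>k. k \<otimes>\<^bsub>G\<^esub> g) (stab Y) {h \<in> carrier G. \<phi> h ` X = Y}"
proof -
  interpret group G by (rule group_G)
  have X: "\<phi> (inv\<^bsub>G\<^esub> g) ` Y = X" using assms image_act_inv by blast
  show ?thesis
  proof (rule bij_betw_byWitness[where f' = "\<lambda>h. h \<otimes>\<^bsub>G\<^esub> inv\<^bsub>G\<^esub> g"])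
    show "(\<lambda>k. k \<otimes>\<^bsub>G\<^esub> g) ` stab Y \<subseteq> {h \<in> carrier G. \<phi> h ` X = Y}"
      by (rule image_subsetI) (use assms in \<open>simp add: stab_eq image_act_compose\<close>)
    show "(\<lambda>h. h \<otimes>\<^bsub>G\<^esub> inv\<^bsub>G\<^esub> g) ` {h \<in> carrier G. \<phi> h ` X = Y} \<subseteq> stab Y"
      by (rule image_subsetI) (use assms X in \<open>simp add: stab_eq image_act_compose\<close>)
  qed (use assms in \<open>simp_all add: stab_eq m_assoc\<close>)
qed

lemma finite_transporter:
  assumes "finite (stab X)"
  shows "finite {h \<in> carrier G. \<phi> h ` X = Y}"
proof (cases "\<exists>g \<in> carrier G. \<phi> g ` X = Y")
  case True
  then obtain g where "g \<in> carrier G" "\<phi> g ` X = Y" by blast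
  then show ?thesis using bij_betw_finite[OF transporter_left] assms by simp
next
  case False
  then have "{h \<in> carrier G. \<phi> h ` X = Y} = {}" by blast
  then show ?thesis by (simp only: finite.emptyI)
qed

lemma tiles_at_facet:
  assumes \<sigma>: "\<sigma> \<in> T" "\<tau> facet_of \<sigma>" and \<sigma>': "\<sigma>' \<in> T" "\<tau> facet_of \<sigma>'" "\<sigma>' \<noteq> \<sigma>"
  shows "{\<rho>. \<rho> \<in> T \<and> \<tau> facet_of \<rho>} = {\<sigma>, \<sigma>'}"
proof -
  obtain \<sigma>'' where "\<sigma>'' \<noteq> \<sigma>" "\<sigma>'' \<in> T" "\<tau> facet_of \<sigma>''"
    and eq: "{\<rho>. \<rho> \<in> T \<and> \<tau> facet_of \<rho>} = {\<sigma>, \<sigma>''}"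
    using facet_two_tiles[OF \<sigma>] .
  have "\<sigma>' \<in> {\<sigma>, \<sigma>''}" unfolding eq[symmetric] using \<sigma>' by simp
  then show ?thesis using \<sigma>'(3) eq by simp
qed

text \<open>
  The stabilizer of a facet permutes the two adjacent tiles, so it is covered by two transporters of
  \<open>\<sigma>\<close>, which are as large as the finite stabilizer of \<open>\<sigma>\<close> unless empty.
\<close>

lemma finite_facet_stabilizer:
  assumes \<sigma>: "\<sigma> \<in> T" "\<tau> facet_of \<sigma>"
  shows "finite (stab \<tau>)"
proof -
  obtain \<sigma>' where \<sigma>': "{\<rho> \<in> T. \<tau> facet_of \<rho>} = {\<sigma>, \<sigma>'}" using facet_two_tiles[OF \<sigma>] .
  have "\<phi> g ` \<sigma> \<in> {\<sigma>, \<sigma>'}" if "g \<in> carrier G" "\<phi> g ` \<tau> = \<tau>" for g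
  proof -
    have "\<phi> g ` \<sigma> \<in> {\<rho> \<in> T. \<tau> facet_of \<rho>}"
      using tiles_invariant[OF that(1) \<sigma>(1)] facet_action[OF that(1) \<sigma>(2)] that(2) by simp
    then show ?thesis by (simp only: \<sigma>')
  qed
  then have "stab \<tau> \<subseteq> (\<Union>\<rho>\<in>{\<sigma>, \<sigma>'}. {g \<in> carrier G. \<phi> g ` \<sigma> = \<rho>})"
    unfolding stab_eq by blast
  moreover have "finite (\<Union>\<rho>\<in>{\<sigma>, \<sigma>'}. {g \<in> carrier G. \<phi> g ` \<sigma> = \<rho>})"
    using finite_transporter[OF finite_stabilizer[OF \<sigma>(1)]] by blast
  ultimately show ?thesis by (rule finite_subset)
qed

lemma card_stab_pos:
  assumes "finite (stab X)"
  shows "card (stab X) > 0"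
proof -
  interpret group G by (rule group_G)
  have "\<phi> \<one>\<^bsub>G\<^esub> ` X = X"
    using image_act_compose[of "\<one>\<^bsub>G\<^esub>" "\<one>\<^bsub>G\<^esub>" X] image_act_inv(1)[of "\<one>\<^bsub>G\<^esub>" X] by simp
  then have "\<one>\<^bsub>G\<^esub> \<in> stab X" by (simp add: stab_eq)
  then show ?thesis using assms card_gt_0_iff by blast
qed

lemma finite_facets: "\<sigma> \<in> T \<Longrightarrow> finite (facets \<sigma>)"
  using finite_polyhedron_facets[OF polyhedral_coneD(5)[OF tile_polyhedral]] by (simp add: facets_def)

text \<open>
  Both sides are \<open>\<Sum> \<eta>(\<tau>, g \<tau>) \<epsilon>(\<sigma>, g \<tau>)\<close> over the finitely many \<open>g\<close> for which \<open>g \<tau>\<close> is a facet of \<open>\<sigma>\<close>,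
  grouped by \<open>g \<tau>\<close> on the left and by \<open>g\<inverse> \<sigma>\<close> on the right.
\<close>

lemma incidence_double_count:
  assumes \<sigma>: "\<sigma> \<in> T" and \<tau>: "\<tau> \<in> codim1_faces T" and nr: "\<not> stabilizer_reverses G \<phi> \<tau>"
  shows "int (card (stab \<tau>)) * incidence G \<phi> ori \<sigma> \<tau> =
    int (card (stab \<sigma>)) * (\<Sum>\<rho> | \<rho> \<in> T \<and> \<tau> facet_of \<rho> \<and> \<rho> \<in> orb \<sigma>. eps_sign ori \<rho> \<tau>)"
proof -
  interpret group G by (rule group_G)
  define A where "A = {g \<in> carrier G. \<phi> g ` \<tau> facet_of \<sigma>}"
  define F where "F = (\<lambda>g. eta_sign G \<phi> ori \<tau> (\<phi> g ` \<tau>) * eps_sign ori \<sigma> (\<phi> g ` \<tau>))"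
  obtain \<sigma>\<^sub>0 where \<sigma>\<^sub>0: "\<sigma>\<^sub>0 \<in> T" "\<tau> facet_of \<sigma>\<^sub>0" using \<tau> by (auto simp: codim1_faces_def facets_def)
  note fin\<tau> = finite_facet_stabilizer[OF \<sigma>\<^sub>0]
  have imA: "(\<lambda>g. \<phi> g ` \<tau>) ` A = orb_in G \<phi> \<sigma> \<tau>"
    by (auto simp: A_def orb_in_def facets_def act_on_sets_def)
  have fibA: "{g \<in> A. \<phi> g ` \<tau> = \<tau>'} = {g \<in> carrier G. \<phi> g ` \<tau> = \<tau>'}" if "\<tau>' facet_of \<sigma>" for \<tau>'
    using that by (auto simp: A_def)
  have "finite (orb_in G \<phi> \<sigma> \<tau>)"
    using finite_facets[OF \<sigma>] by (simp add: orb_in_def)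
  moreover have "A \<subseteq> (\<Union>\<tau>'\<in>orb_in G \<phi> \<sigma> \<tau>. {g \<in> carrier G. \<phi> g ` \<tau> = \<tau>'})"
    using imA by (auto simp: A_def)
  ultimately have finA: "finite A"
    using finite_transporter[OF fin\<tau>] by (meson finite_UN_I finite_subset)
  have "sum F A = (\<Sum>\<tau>'\<in>orb_in G \<phi> \<sigma> \<tau>. \<Sum>g | g \<in> A \<and> \<phi> g ` \<tau> = \<tau>'. F g)"
    using sum.image_gen[OF finA, of F "\<lambda>g. \<phi> g ` \<tau>"] by (simp only: imA)
  also have "\<dots> = (\<Sum>\<tau>'\<in>orb_in G \<phi> \<sigma> \<tau>. int (card (stab \<tau>)) *
      (eta_sign G \<phi> ori \<tau> \<tau>' * eps_sign ori \<sigma> \<tau>'))"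
  proof (rule sum.cong[OF refl])
    fix \<tau>' assume "\<tau>' \<in> orb_in G \<phi> \<sigma> \<tau>"
    then obtain g where g: "g \<in> carrier G" "\<phi> g ` \<tau> = \<tau>'" "\<tau>' facet_of \<sigma>"
      by (auto simp: orb_in_def facets_def act_on_sets_def)
    have "card {g \<in> A. \<phi> g ` \<tau> = \<tau>'} = card (stab \<tau>)"
      using bij_betw_same_card[OF transporter_left[OF g(1,2)]] fibA[OF g(3)] by simp
    moreover have "(\<Sum>g | g \<in> A \<and> \<phi> g ` \<tau> = \<tau>'. F g) =
        (\<Sum>g | g \<in> A \<and> \<phi> g ` \<tau> = \<tau>'. eta_sign G \<phi> ori \<tau> \<tau>' * eps_sign ori \<sigma> \<tau>')"
      by (intro sum.cong) (auto simp: F_def)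
    ultimately show "(\<Sum>g | g \<in> A \<and> \<phi> g ` \<tau> = \<tau>'. F g) =
        int (card (stab \<tau>)) * (eta_sign G \<phi> ori \<tau> \<tau>' * eps_sign ori \<sigma> \<tau>')"
      by simp
  qed
  also have "\<dots> = int (card (stab \<tau>)) * incidence G \<phi> ori \<sigma> \<tau>"
    by (simp add: incidence_def sum_distrib_left)
  finally have 1: "sum F A = int (card (stab \<tau>)) * incidence G \<phi> ori \<sigma> \<tau>" .
  define N where "N = {\<rho>. \<rho> \<in> T \<and> \<tau> facet_of \<rho> \<and> \<rho> \<in> orb \<sigma>}"
  have pull: "\<tau> facet_of \<phi> (inv\<^bsub>G\<^esub> g) ` \<sigma>" if "g \<in> carrier G" "\<phi> g ` \<tau> facet_of \<sigma>" for g
    using facet_action[of "inv\<^bsub>G\<^esub> g", OF _ that(2)] that(1) by (simp add: image_act_inv)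
  have inA: "g \<in> A \<and> \<phi> (inv\<^bsub>G\<^esub> g) ` \<sigma> = \<rho> \<longleftrightarrow> g \<in> carrier G \<and> \<phi> g ` \<rho> = \<sigma>"
    if \<rho>: "\<rho> \<in> N" for g \<rho>
  proof
    assume L: "g \<in> A \<and> \<phi> (inv\<^bsub>G\<^esub> g) ` \<sigma> = \<rho>"
    then have g: "g \<in> carrier G" by (simp add: A_def)
    then show "g \<in> carrier G \<and> \<phi> g ` \<rho> = \<sigma>" using image_act_inv(2)[OF g, of \<sigma>] L by simp
  next
    assume R: "g \<in> carrier G \<and> \<phi> g ` \<rho> = \<sigma>"
    then show "g \<in> A \<and> \<phi> (inv\<^bsub>G\<^esub> g) ` \<sigma> = \<rho>"
      using image_act_inv(1)[of g \<rho>] facet_action[of g \<tau> \<rho>] \<rho> by (simp add: A_def N_def)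
  qed
  have imB: "(\<lambda>g. \<phi> (inv\<^bsub>G\<^esub> g) ` \<sigma>) ` A = N"
  proof (intro equalityI subsetI)
    fix \<rho> assume "\<rho> \<in> (\<lambda>g. \<phi> (inv\<^bsub>G\<^esub> g) ` \<sigma>) ` A"
    then obtain g where "g \<in> A" and \<rho>: "\<rho> = \<phi> (inv\<^bsub>G\<^esub> g) ` \<sigma>" by (rule imageE)
    then have g: "g \<in> carrier G" "\<phi> g ` \<tau> facet_of \<sigma>" by (simp_all add: A_def)
    then have "\<rho> \<in> orb \<sigma>" unfolding orb_eq \<rho> by blast
    then show "\<rho> \<in> N"
      using tiles_invariant[of "inv\<^bsub>G\<^esub> g", OF _ \<sigma>] pull[OF g] g(1) by (simp add: N_def \<rho>)
  next
    fix \<rho> assume \<rho>: "\<rho> \<in> N"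
    then have "\<sigma> \<in> orb \<rho>" using orb_sym by (simp add: N_def)
    then obtain g where "g \<in> carrier G" "\<phi> g ` \<rho> = \<sigma>" unfolding orb_eq by blast
    then show "\<rho> \<in> (\<lambda>g. \<phi> (inv\<^bsub>G\<^esub> g) ` \<sigma>) ` A" using inA[OF \<rho>] by blast
  qed
  have "sum F A = (\<Sum>\<rho>\<in>N. \<Sum>g | g \<in> A \<and> \<phi> (inv\<^bsub>G\<^esub> g) ` \<sigma> = \<rho>. F g)"
    using sum.image_gen[OF finA, of F "\<lambda>g. \<phi> (inv\<^bsub>G\<^esub> g) ` \<sigma>"] by (simp only: imB)
  also have "\<dots> = (\<Sum>\<rho>\<in>N. int (card (stab \<sigma>)) * eps_sign ori \<rho> \<tau>)"
  proof (rule sum.cong[OF refl])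
    fix \<rho> assume \<rho>: "\<rho> \<in> N"
    have fib: "{g. g \<in> A \<and> \<phi> (inv\<^bsub>G\<^esub> g) ` \<sigma> = \<rho>} = {g \<in> carrier G. \<phi> g ` \<rho> = \<sigma>}"
      using inA[OF \<rho>] by blast
    have "\<sigma> \<in> orb \<rho>" using \<rho> orb_sym by (simp add: N_def)
    then obtain g where g: "g \<in> carrier G" "\<phi> g ` \<rho> = \<sigma>" unfolding orb_eq by blast
    have "F h = eps_sign ori \<rho> \<tau>" if "h \<in> carrier G" "\<phi> h ` \<rho> = \<sigma>" for h
      using eta_eps_equivariant[OF _ _ nr that(1), of \<rho>] \<rho> that(2) by (simp add: F_def N_def)
    then have "(\<Sum>g | g \<in> A \<and> \<phi> (inv\<^bsub>G\<^esub> g) ` \<sigma> = \<rho>. F g) =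
        (\<Sum>g \<in> {g \<in> carrier G. \<phi> g ` \<rho> = \<sigma>}. eps_sign ori \<rho> \<tau>)"
      unfolding fib by (intro sum.cong) auto
    then show "(\<Sum>g | g \<in> A \<and> \<phi> (inv\<^bsub>G\<^esub> g) ` \<sigma> = \<rho>. F g) = int (card (stab \<sigma>)) * eps_sign ori \<rho> \<tau>"
      using bij_betw_same_card[OF transporter_right[OF g]] by simp
  qed
  also have "\<dots> = int (card (stab \<sigma>)) * (\<Sum>\<rho>\<in>N. eps_sign ori \<rho> \<tau>)"
    by (simp add: sum_distrib_left)
  finally show ?thesis using 1 by (simp add: N_def)
qed

text \<open>
  The function \<open>\<mu>\<close> described at the top. When \<open>S\<close> consists of representatives, the sum has at most
  one term; as a sum over \<open>S\<close> it can be exchanged with the sum over the tiles at a facet.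
\<close>

definition spread :: "'n rvec set set \<Rightarrow> ('n rvec set \<Rightarrow> rat) \<Rightarrow> 'n rvec set \<Rightarrow> rat" where
  "spread S lam \<rho> = (\<Sum>\<sigma> | \<sigma> \<in> S \<and> \<rho> \<in> orb \<sigma>. lam \<sigma> * of_nat (card (stab \<sigma>)))"

lemma spread_orbit:
  assumes "\<rho>' \<in> orb \<rho>"
  shows "spread S lam \<rho>' = spread S lam \<rho>"
proof -
  have "\<rho>' \<in> orb \<sigma> \<longleftrightarrow> \<rho> \<in> orb \<sigma>" for \<sigma> using assms orb_trans orb_sym by blast
  then show ?thesis by (simp add: spread_def)
qed

text \<open>
  Weight the double count by \<open>\<lambda>\<^sub>\<sigma>\<close> and exchange the sums over \<open>\<sigma> \<in> S\<close> and over the tiles at \<open>\<tau>\<close>.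
\<close>

lemma coefficient_eq:
  assumes S: "finite S" "S \<subseteq> T" and \<tau>: "\<tau> \<in> codim1_faces T" "\<not> stabilizer_reverses G \<phi> \<tau>"
  shows "of_nat (card (stab \<tau>)) * (\<Sum>\<sigma>\<in>S. lam \<sigma> * of_int (incidence G \<phi> ori \<sigma> \<tau>)) =
    (\<Sum>\<rho> | \<rho> \<in> T \<and> \<tau> facet_of \<rho>. of_int (eps_sign ori \<rho> \<tau>) * spread S lam \<rho>)"
proof -
  define N where "N = {\<rho> \<in> T. \<tau> facet_of \<rho>}"
  obtain \<sigma>\<^sub>0 where \<sigma>\<^sub>0: "\<sigma>\<^sub>0 \<in> T" "\<tau> facet_of \<sigma>\<^sub>0" using \<tau> by (auto simp: codim1_faces_def facets_def)
  have finN: "finite N"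
    by (rule facet_two_tiles[OF \<sigma>\<^sub>0]) (simp add: N_def)
  have "of_nat (card (stab \<tau>)) * (\<Sum>\<sigma>\<in>S. lam \<sigma> * of_int (incidence G \<phi> ori \<sigma> \<tau>)) =
      (\<Sum>\<sigma>\<in>S. lam \<sigma> * of_int (int (card (stab \<tau>)) * incidence G \<phi> ori \<sigma> \<tau>))"
    by (simp add: sum_distrib_left mult_ac)
  also have "\<dots> = (\<Sum>\<sigma>\<in>S. lam \<sigma> * of_int (int (card (stab \<sigma>)) *
      (\<Sum>\<rho> | \<rho> \<in> T \<and> \<tau> facet_of \<rho> \<and> \<rho> \<in> orb \<sigma>. eps_sign ori \<rho> \<tau>)))"
    using S \<tau> by (intro sum.cong refl) (simp add: incidence_double_count subset_iff)
  also have "\<dots> = (\<Sum>\<sigma>\<in>S. \<Sum>\<rho>\<in>N. if \<rho> \<in> orb \<sigma>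
      then of_int (eps_sign ori \<rho> \<tau>) * (lam \<sigma> * of_nat (card (stab \<sigma>))) else 0)"
  proof (intro sum.cong refl)
    fix \<sigma>
    have "{\<rho>. \<rho> \<in> T \<and> \<tau> facet_of \<rho> \<and> \<rho> \<in> orb \<sigma>} = {\<rho> \<in> N. \<rho> \<in> orb \<sigma>}" by (auto simp: N_def)
    then show "lam \<sigma> * of_int (int (card (stab \<sigma>)) *
      (\<Sum>\<rho> | \<rho> \<in> T \<and> \<tau> facet_of \<rho> \<and> \<rho> \<in> orb \<sigma>. eps_sign ori \<rho> \<tau>)) =
      (\<Sum>\<rho>\<in>N. if \<rho> \<in> orb \<sigma> then of_int (eps_sign ori \<rho> \<tau>) * (lam \<sigma> * of_nat (card (stab \<sigma>))) else 0)"
      using finN by (simp add: sum.inter_filter[symmetric] sum_distrib_left mult_ac)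
  qed
  also have "\<dots> = (\<Sum>\<rho>\<in>N. \<Sum>\<sigma>\<in>S. if \<rho> \<in> orb \<sigma>
      then of_int (eps_sign ori \<rho> \<tau>) * (lam \<sigma> * of_nat (card (stab \<sigma>))) else 0)"
    by (rule sum.swap)
  also have "\<dots> = (\<Sum>\<rho>\<in>N. of_int (eps_sign ori \<rho> \<tau>) * spread S lam \<rho>)"
    using S(1) by (intro sum.cong refl) (simp add: spread_def sum_distrib_left sum.inter_filter[symmetric])
  finally show ?thesis by (simp add: N_def)
qed

lemma coefficient_zero_iff:
  assumes S: "finite S" "S \<subseteq> T" and nr: "\<not> stabilizer_reverses G \<phi> \<tau>"
    and \<sigma>: "\<sigma> \<in> T" "\<tau> facet_of \<sigma>" and \<sigma>': "\<sigma>' \<in> T" "\<tau> facet_of \<sigma>'" "\<sigma>' \<noteq> \<sigma>"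
  shows "(\<Sum>\<sigma>\<in>S. lam \<sigma> * of_int (incidence G \<phi> ori \<sigma> \<tau>)) = 0 \<longleftrightarrow> spread S lam \<sigma> = spread S lam \<sigma>'"
proof -
  have N: "{\<rho>. \<rho> \<in> T \<and> \<tau> facet_of \<rho>} = {\<sigma>, \<sigma>'}"
    by (rule tiles_at_facet[OF \<sigma> \<sigma>'])
  have e: "eps_sign ori \<sigma>' \<tau> = - eps_sign ori \<sigma> \<tau>"
    using eps_sign_opposite[OF \<sigma> \<sigma>'(1,2)] \<sigma>'(3) by blast
  have nz: "eps_sign ori \<sigma> \<tau> \<noteq> 0" by (simp add: eps_sign_def)
  let ?c = "\<Sum>\<sigma>\<in>S. lam \<sigma> * of_int (incidence G \<phi> ori \<sigma> \<tau>)"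
  have eq: "of_nat (card (stab \<tau>)) * ?c =
      of_int (eps_sign ori \<sigma> \<tau>) * (spread S lam \<sigma> - spread S lam \<sigma>')"
    using coefficient_eq[OF S codim1_face[OF \<sigma>] nr, of lam] \<sigma>'(3) by (simp add: N e algebra_simps)
  have "card (stab \<tau>) > 0" by (rule card_stab_pos[OF finite_facet_stabilizer[OF \<sigma>]])
  then have "?c = 0 \<longleftrightarrow> of_nat (card (stab \<tau>)) * ?c = 0" by simp
  also have "\<dots> \<longleftrightarrow> spread S lam \<sigma> = spread S lam \<sigma>'" unfolding eq using nz by simp
  finally show ?thesis .
qed

text \<open>
  Such facets contribute no coefficient to the boundary, but no condition is lost: an element that
  reverses \<open>\<tau>\<close> exchanges its two tiles, which are therefore in the same orbit.
\<close>

lemma spread_equal_if_reversed: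
  assumes "stabilizer_reverses G \<phi> \<tau>"
    and \<sigma>: "\<sigma> \<in> T" "\<tau> facet_of \<sigma>" and \<sigma>': "\<sigma>' \<in> T" "\<tau> facet_of \<sigma>'" "\<sigma>' \<noteq> \<sigma>"
  shows "spread S lam \<sigma> = spread S lam \<sigma>'"
proof -
  obtain g where g: "g \<in> carrier G" "\<phi> g ` \<tau> = \<tau>" "det_on (span \<tau>) (\<phi> g) < 0"
    using assms(1) by (auto simp: stabilizer_reverses_def stabilizer_def act_on_sets_def)
  have "\<phi> g ` \<sigma> \<in> T" "\<tau> facet_of \<phi> g ` \<sigma>"
    using tiles_invariant[OF g(1) \<sigma>(1)] facet_action[OF g(1) \<sigma>(2)] g(2) by auto
  moreover have "\<phi> g ` \<sigma> \<noteq> \<sigma>" by (rule reversing_moves_tile[OF \<sigma> g])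
  ultimately have "\<phi> g ` \<sigma> \<in> {\<sigma>, \<sigma>'} - {\<sigma>}"
    unfolding tiles_at_facet[OF \<sigma> \<sigma>', symmetric] by simp
  then have "\<sigma>' = \<phi> g ` \<sigma>" by blast
  then have "\<sigma>' \<in> orb \<sigma>" using g(1) unfolding orb_eq by blast
  then show ?thesis using spread_orbit by simp
qed

text \<open>
  The coefficients are only known at representatives \<open>\<tau>\<^sub>0 = g \<tau>\<close>; invariance of \<open>spread\<close> carries the
  conclusion from the tiles at \<open>\<tau>\<^sub>0\<close> back to those at \<open>\<tau>\<close>.
\<close>

lemma spread_constant:
  assumes S: "finite S" "S \<subseteq> T"
    and reps: "representatives G \<phi> {\<tau> \<in> codim1_faces T. \<not> stabilizer_reverses G \<phi> \<tau>} R"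
    and zero: "\<And>\<tau>. \<tau> \<in> R \<Longrightarrow> (\<Sum>\<sigma>\<in>S. lam \<sigma> * of_int (incidence G \<phi> ori \<sigma> \<tau>)) = 0"
    and \<rho>: "\<rho> \<in> T" "\<rho>' \<in> T"
  shows "spread S lam \<rho> = spread S lam \<rho>'"
proof (rule constant_if_adjacent_equal[OF _ \<rho>])
  fix \<tau> \<sigma> \<sigma>' assume \<sigma>: "\<sigma> \<in> T" and \<sigma>': "\<sigma>' \<in> T" and \<tau>: "\<tau> facet_of \<sigma>" "\<tau> facet_of \<sigma>'"
  show "spread S lam \<sigma> = spread S lam \<sigma>'"
  proof (cases "\<sigma>' = \<sigma> \<or> stabilizer_reverses G \<phi> \<tau>")
    case True
    then show ?thesis using spread_equal_if_reversed[OF _ \<sigma> \<tau>(1) \<sigma>' \<tau>(2)] by blast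
  next
    case False
    then have "\<tau> \<in> {\<tau> \<in> codim1_faces T. \<not> stabilizer_reverses G \<phi> \<tau>}" using codim1_face[OF \<sigma> \<tau>(1)] by simp
    then obtain \<tau>\<^sub>0 where \<tau>\<^sub>0: "\<tau>\<^sub>0 \<in> R" "\<tau>\<^sub>0 \<in> orb \<tau>"
      using reps unfolding representatives_def by blast
    then obtain g where g: "g \<in> carrier G" "\<tau>\<^sub>0 = \<phi> g ` \<tau>" unfolding orb_eq by blast
    have nr: "\<not> stabilizer_reverses G \<phi> \<tau>\<^sub>0" using \<tau>\<^sub>0(1) reps by (auto simp: representatives_def)
    have "\<phi> g ` \<sigma>' \<noteq> \<phi> g ` \<sigma>" using False inj_action[OF g(1)] by (simp add: inj_image_eq_iff)
    then have "spread S lam (\<phi> g ` \<sigma>) = spread S lam (\<phi> g ` \<sigma>')"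
      using coefficient_zero_iff[OF S nr, of "\<phi> g ` \<sigma>" "\<phi> g ` \<sigma>'"] zero[OF \<tau>\<^sub>0(1)]
        tiles_invariant[OF g(1)] \<sigma> \<sigma>' facet_action[OF g(1)] \<tau> g(2) by blast
    moreover have "\<phi> g ` \<sigma> \<in> orb \<sigma>" "\<phi> g ` \<sigma>' \<in> orb \<sigma>'" using g(1) unfolding orb_eq by blast+
    ultimately show ?thesis using spread_orbit by metis
  qed
qed

lemma representative_unique:
  assumes reps: "representatives G \<phi> F R" and X: "X \<in> F"
    and r: "r \<in> R" "r \<in> orb X" and s: "s \<in> R" "s \<in> orb X"
  shows "r = s"
proof -
  have "\<exists>!\<rho>. \<rho> \<in> R \<and> \<rho> \<in> orb X" using reps X by (simp add: representatives_def)
  then obtain \<rho> where "\<And>y. y \<in> R \<and> y \<in> orb X \<Longrightarrow> y = \<rho>" by (elim ex1E) blast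
  then show ?thesis using r s by metis
qed

lemma tile_representatives:
  assumes "representatives G \<phi> {\<sigma> \<in> T. \<not> stabilizer_reverses G \<phi> \<sigma>} R"
  shows "R \<subseteq> T" "\<And>\<sigma>. \<sigma> \<in> T \<Longrightarrow> \<exists>\<rho>. \<rho> \<in> R \<and> \<rho> \<in> orb \<sigma>"
    and "\<And>\<sigma> \<rho>. \<sigma> \<in> R \<Longrightarrow> \<rho> \<in> R \<Longrightarrow> \<rho> \<in> orb \<sigma> \<Longrightarrow> \<rho> = \<sigma>"
proof -
  have F: "{\<sigma> \<in> T. \<not> stabilizer_reverses G \<phi> \<sigma>} = T" using tile_not_reversed by blast
  note reps = assms[unfolded F]
  show sub: "R \<subseteq> T" using reps by (simp add: representatives_def)
  show "\<exists>\<rho>. \<rho> \<in> R \<and> \<rho> \<in> orb \<sigma>" if "\<sigma> \<in> T" for \<sigma>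
    using reps that by (simp add: representatives_def ex1_implies_ex)
  show "\<rho> = \<sigma>" if "\<sigma> \<in> R" "\<rho> \<in> R" "\<rho> \<in> orb \<sigma>" for \<sigma> \<rho>
    using representative_unique[OF reps _ that(2,3,1) orb_refl] sub that(1) by blast
qed

lemma finite_tile_representatives:
  assumes reps: "representatives G \<phi> {\<sigma> \<in> T. \<not> stabilizer_reverses G \<phi> \<sigma>} R"
    and fin: "finite (orbits G T (act_on_sets \<phi>))"
  shows "finite R"
proof -
  note R = tile_representatives[OF reps]
  have "inj_on orb R"
  proof (rule inj_onI)
    fix \<sigma> \<rho> assume \<sigma>\<rho>: "\<sigma> \<in> R" "\<rho> \<in> R" and e: "orb \<sigma> = orb \<rho>"
    have "\<rho> \<in> orb \<sigma>" unfolding e by (rule orb_refl)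
    then show "\<sigma> = \<rho>" using R(3)[OF \<sigma>\<rho>] by simp
  qed
  moreover have "orb ` R \<subseteq> orbits G T (act_on_sets \<phi>)" using R(1) by (auto simp: orbits_def)
  ultimately show ?thesis using fin by (meson finite_imageD finite_subset)
qed

text \<open>
  Every facet is in the orbit of a facet of one of the finitely many tile representatives. Without
  this the inner sum of the theorem would not range over a finite set and would be 0 by default.
\<close>

lemma finite_facet_representatives:
  assumes reps: "representatives G \<phi> {\<sigma> \<in> T. \<not> stabilizer_reverses G \<phi> \<sigma>} R"
    and fin: "finite R"
    and reps1: "representatives G \<phi> {\<tau> \<in> codim1_faces T. \<not> stabilizer_reverses G \<phi> \<tau>} R1"
  shows "finite R1"
proof -
  note R = tile_representatives[OF reps]
  define f where "f x = (SOME r. r \<in> R1 \<and> r \<in> orb x)" for x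
  have "R1 \<subseteq> f ` (\<Union>\<sigma>\<in>R. facets \<sigma>)"
  proof
    fix \<tau> assume \<tau>: "\<tau> \<in> R1"
    then have F: "\<tau> \<in> {\<tau> \<in> codim1_faces T. \<not> stabilizer_reverses G \<phi> \<tau>}"
      using reps1 by (auto simp: representatives_def)
    then obtain \<sigma> where \<sigma>: "\<sigma> \<in> T" "\<tau> facet_of \<sigma>" by (auto simp: codim1_faces_def facets_def)
    obtain g where g: "g \<in> carrier G" "\<phi> g ` \<sigma> \<in> R" using R(2)[OF \<sigma>(1)] unfolding orb_eq by blast
    define x where "x = \<phi> g ` \<tau>"
    have x: "x \<in> (\<Union>\<sigma>\<in>R. facets \<sigma>)" "x \<in> orb \<tau>"
      using facet_action[OF g(1) \<sigma>(2)] g unfolding x_def facets_def orb_eq by blast+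
    have "\<tau> \<in> R1 \<and> \<tau> \<in> orb x" using \<tau> orb_sym[OF x(2)] by (rule conjI)
    then have "f x \<in> R1 \<and> f x \<in> orb x" unfolding f_def by (rule someI)
    then have "f x \<in> R1" "f x \<in> orb \<tau>" using orb_trans[OF x(2)] by simp_all
    then have "f x = \<tau>" by (rule representative_unique[OF reps1 F _ _ \<tau> orb_refl])
    then show "\<tau> \<in> f ` (\<Union>\<sigma>\<in>R. facets \<sigma>)" using x(1) by blast
  qed
  moreover have "finite (\<Union>\<sigma>\<in>R. facets \<sigma>)" using fin R(1) finite_facets by blast
  ultimately show ?thesis using finite_surj by blast
qed

lemma spread_representative:
  assumes reps: "representatives G \<phi> {\<sigma> \<in> T. \<not> stabilizer_reverses G \<phi> \<sigma>} R"
    and S: "S \<subseteq> R" and \<sigma>: "\<sigma> \<in> R"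
  shows "spread S lam \<sigma> = (if \<sigma> \<in> S then lam \<sigma> * of_nat (card (stab \<sigma>)) else 0)"
proof -
  note R = tile_representatives[OF reps]
  have "\<rho> = \<sigma>" if "\<rho> \<in> R" "\<sigma> \<in> orb \<rho>" for \<rho>
    using R(3)[OF that(1) \<sigma> that(2)] by simp
  then have "{\<rho>. \<rho> \<in> S \<and> \<sigma> \<in> orb \<rho>} = (if \<sigma> \<in> S then {\<sigma>} else {})"
    using S orb_refl by auto
  then show ?thesis by (simp add: spread_def)
qed

lemma boundary_zero_iff:
  assumes fin: "finite (orbits G T (act_on_sets \<phi>))"
    and reps: "representatives G \<phi> {\<sigma> \<in> T. \<not> stabilizer_reverses G \<phi> \<sigma>} R"
    and reps1: "representatives G \<phi> {\<tau> \<in> codim1_faces T. \<not> stabilizer_reverses G \<phi> \<tau>} R1"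
    and S: "S \<subseteq> R" and lam: "\<exists>\<sigma>\<in>S. lam \<sigma> \<noteq> 0"
  shows "(\<forall>\<tau>\<in>R1. (\<Sum>\<sigma>\<in>S. lam \<sigma> * of_int (incidence G \<phi> ori \<sigma> \<tau>)) = 0) \<longleftrightarrow>
    S = R \<and> (\<exists>l :: rat. \<forall>\<sigma>\<in>S. lam \<sigma> = l / of_nat (card (stab \<sigma>)))"
proof -
  note R = tile_representatives[OF reps]
  have finS: "finite S" using finite_tile_representatives[OF reps fin] S finite_subset by blast
  have ST: "S \<subseteq> T" using S R(1) by blast
  have cpos: "card (stab \<sigma>) > 0" if "\<sigma> \<in> T" for \<sigma> using card_stab_pos finite_stabilizer that by blast
  note spread_R = spread_representative[OF reps S, of _ lam]
  show ?thesis
  proof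
    assume "\<forall>\<tau>\<in>R1. (\<Sum>\<sigma>\<in>S. lam \<sigma> * of_int (incidence G \<phi> ori \<sigma> \<tau>)) = 0"
    then have const: "spread S lam \<rho> = spread S lam \<rho>'" if "\<rho> \<in> T" "\<rho>' \<in> T" for \<rho> \<rho>'
      using spread_constant[OF finS ST reps1 _ that] by blast
    obtain \<sigma>\<^sub>0 where \<sigma>\<^sub>0: "\<sigma>\<^sub>0 \<in> S" "lam \<sigma>\<^sub>0 \<noteq> 0" using lam by blast
    define l where "l = spread S lam \<sigma>\<^sub>0"
    have in_R: "\<sigma>\<^sub>0 \<in> R" and in_T: "\<sigma>\<^sub>0 \<in> T" using \<sigma>\<^sub>0 S ST by blast+
    have l: "l \<noteq> 0" using \<sigma>\<^sub>0 spread_R[OF in_R] cpos[OF in_T] by (simp add: l_def)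
    have all: "spread S lam \<sigma> = l" if "\<sigma> \<in> R" for \<sigma>
      unfolding l_def using const in_T R(1) that by blast
    have "\<sigma> \<in> S" if "\<sigma> \<in> R" for \<sigma> using all[OF that] spread_R[OF that] l by (simp split: if_splits)
    then have "S = R" using S by blast
    moreover have "lam \<sigma> = l / of_nat (card (stab \<sigma>))" if "\<sigma> \<in> S" for \<sigma>
    proof -
      have "\<sigma> \<in> R" "\<sigma> \<in> T" using that S ST by blast+
      then show ?thesis using all[of \<sigma>] spread_R[of \<sigma>] that cpos[of \<sigma>] by (simp add: field_simps)
    qed
    ultimately show "S = R \<and> (\<exists>l :: rat. \<forall>\<sigma>\<in>S. lam \<sigma> = l / of_nat (card (stab \<sigma>)))" by blast
  next
    assume "S = R \<and> (\<exists>l :: rat. \<forall>\<sigma>\<in>S. lam \<sigma> = l / of_nat (card (stab \<sigma>)))"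
    then obtain l where SR: "S = R" and l: "\<And>\<sigma>. \<sigma> \<in> S \<Longrightarrow> lam \<sigma> = l / of_nat (card (stab \<sigma>))" by blast
    have const: "spread S lam \<rho> = l" if "\<rho> \<in> T" for \<rho>
    proof -
      obtain \<sigma> where \<sigma>: "\<sigma> \<in> R" "\<sigma> \<in> orb \<rho>" using R(2)[OF \<open>\<rho> \<in> T\<close>] by blast
      have "spread S lam \<rho> = spread S lam \<sigma>" using spread_orbit[OF \<sigma>(2)] by simp
      also have "\<dots> = l" using spread_R[OF \<sigma>(1)] l[of \<sigma>] \<sigma>(1) SR cpos[of \<sigma>] R(1) by auto
      finally show ?thesis .
    qed
    show "\<forall>\<tau>\<in>R1. (\<Sum>\<sigma>\<in>S. lam \<sigma> * of_int (incidence G \<phi> ori \<sigma> \<tau>)) = 0"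
    proof
      fix \<tau> assume "\<tau> \<in> R1"
      then have \<tau>: "\<tau> \<in> codim1_faces T" "\<not> stabilizer_reverses G \<phi> \<tau>"
        using reps1 by (auto simp: representatives_def)
      then obtain \<sigma> where \<sigma>: "\<sigma> \<in> T" "\<tau> facet_of \<sigma>" by (auto simp: codim1_faces_def facets_def)
      obtain \<sigma>' where \<sigma>': "\<sigma>' \<noteq> \<sigma>" "\<sigma>' \<in> T" "\<tau> facet_of \<sigma>'" using facet_two_tiles[OF \<sigma>] .
      show "(\<Sum>\<sigma>\<in>S. lam \<sigma> * of_int (incidence G \<phi> ori \<sigma> \<tau>)) = 0"
        using coefficient_zero_iff[OF finS ST \<tau>(2) \<sigma> \<sigma>'(2,3,1)] const \<sigma>(1) \<sigma>'(2) by simp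
    qed
  qed
qed

end

section \<open>The boundary of a chain of tiles\<close>

lemma lookup_scale_rat: "Poly_Mapping.lookup (scale_rat q x) k = q * Poly_Mapping.lookup x k"
  by (simp add: scale_rat_def Poly_Mapping.map.rep_eq when_def)

lemma sum_lookup_single:
  assumes "finite R"
  shows "(\<Sum>\<tau>\<in>R. Poly_Mapping.lookup (Poly_Mapping.single \<tau> (c \<tau>)) k) = (if k \<in> R then c k else 0)"
  using assms by (simp add: lookup_single when_def)

theorem theorem0p2:
  fixes C :: "'n::{finite,linorder} rvec set"
    and T :: "'n rvec set set"
    and G :: "('g, 'k) monoid_scheme"
    and \<phi> :: "'g \<Rightarrow> 'n rvec \<Rightarrow> 'n rvec"
    and ori :: "'n rvec set \<Rightarrow> 'n rvec list set"
    and \<Sigma>0 \<Sigma>1 S :: "'n rvec set set"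
    and lam :: "'n rvec set \<Rightarrow> rat"
  assumes "open_convex_cone C"
    and "contains_no_lines (closure C)"
    and "tessellation C T"
    and "locally_finite_on C T"
    and "\<And>\<sigma>. \<sigma> \<in> T \<Longrightarrow>
           polyhedral_cone \<sigma> \<and> aff_dim \<sigma> = int CARD('n) \<and> \<sigma> \<subseteq> closure C"
    and "\<And>\<tau>. \<tau> \<in> codim1_faces T \<Longrightarrow> card {\<sigma> \<in> T. \<tau> \<in> facets \<sigma>} = 2"
    and "group_action G UNIV \<phi>"
    and "\<And>g. g \<in> carrier G \<Longrightarrow> linear (\<phi> g)"
    and "\<And>g. g \<in> carrier G \<Longrightarrow> Determinants.det (matrix (\<phi> g)) > 0"
    and "\<And>g \<sigma>. g \<in> carrier G \<Longrightarrow> \<sigma> \<in> T \<Longrightarrow> act_on_sets \<phi> g \<sigma> \<in> T"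
    and "finite (orbits G T (act_on_sets \<phi>))"
    and "\<And>\<sigma>. \<sigma> \<in> T \<Longrightarrow> finite (stabilizer G (act_on_sets \<phi>) \<sigma>)"
    and "\<And>\<tau>. \<tau> \<in> codim1_faces T \<Longrightarrow> ori \<tau> \<in> orientations (span \<tau>)"
    and "representatives G \<phi> {\<sigma> \<in> T. \<not> stabilizer_reverses G \<phi> \<sigma>} \<Sigma>0"
    and "representatives G \<phi> {\<tau> \<in> codim1_faces T. \<not> stabilizer_reverses G \<phi> \<tau>} \<Sigma>1"
    and "S \<subseteq> \<Sigma>0"
    and "\<exists>\<sigma>\<in>S. lam \<sigma> \<noteq> 0"
  shows "(\<Sum>\<sigma>\<in>S. scale_rat (lam \<sigma>)
            (\<Sum>\<tau>\<in>\<Sigma>1. Poly_Mapping.single \<tau> (of_int (incidence G \<phi> ori \<sigma> \<tau>)))) = 0 \<longleftrightarrow>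
         S = \<Sigma>0 \<and>
         (\<exists>l :: rat. \<forall>\<sigma>\<in>S. lam \<sigma> = l / of_nat (card (stabilizer G (act_on_sets \<phi>) \<sigma>)))"
proof -
  interpret tessellation_action C T G \<phi> ori
  proof (intro tessellation_action.intro cone_tessellation.intro tessellation_action_axioms.intro)
    show "\<And>\<sigma> x. \<sigma> \<in> T \<Longrightarrow> x \<in> \<sigma> \<Longrightarrow> - x \<in> \<sigma> \<Longrightarrow> x = 0"
      using contains_no_lines_pointed[OF assms(2)] assms(5) unfolding polyhedral_cone_def by metis
    show "\<And>\<sigma> \<sigma>'. \<sigma> \<in> T \<Longrightarrow> \<sigma>' \<in> T \<Longrightarrow> \<sigma> \<noteq> \<sigma>' \<Longrightarrow> interior \<sigma> \<inter> interior \<sigma>' = {}"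
      using assms(3) unfolding tessellation_def pairwise_def by blast
  qed (use assms in \<open>simp_all add: open_convex_cone_def tessellation_def full_cone_def act_on_sets_def\<close>)
  define x where "x = (\<Sum>\<sigma>\<in>S. scale_rat (lam \<sigma>)
      (\<Sum>\<tau>\<in>\<Sigma>1. Poly_Mapping.single \<tau> (of_int (incidence G \<phi> ori \<sigma> \<tau>))))"
  have fin: "finite \<Sigma>0" by (rule finite_tile_representatives[OF assms(14,11)])
  have fin1: "finite \<Sigma>1" by (rule finite_facet_representatives[OF assms(14) fin assms(15)])
  have "Poly_Mapping.lookup x \<tau> =
      (if \<tau> \<in> \<Sigma>1 then (\<Sum>\<sigma>\<in>S. lam \<sigma> * of_int (incidence G \<phi> ori \<sigma> \<tau>)) else 0)" for \<tau>
    by (simp add: x_def Poly_Mapping.lookup_sum lookup_scale_rat sum_lookup_single[OF fin1])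
  then have "x = 0 \<longleftrightarrow> (\<forall>\<tau>\<in>\<Sigma>1. (\<Sum>\<sigma>\<in>S. lam \<sigma> * of_int (incidence G \<phi> ori \<sigma> \<tau>)) = 0)"
    by (auto simp: poly_mapping_eq_iff fun_eq_iff)
  then show ?thesis
    using boundary_zero_iff[OF assms(11,14-17)] by (simp add: x_def)
qed

end
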